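(* Consider the uplink system model described in the context, and suppose the IOS phase shifts are chosen so that $|\overline{\mathbf a}^{(\mathrm{IOS})\mathrm H}_{\mathrm i}\mathbf\Theta_{\mathrm i}\overline{\mathbf g}_{\mathrm i}|^2=N_{\mathrm i}^2$ for both $\mathrm i\in\{\mathrm r,\mathrm t\}$. For $\mathrm i\in\{\mathrm r,\mathrm t\}$ let $\bar{\mathrm i}$ denote the other user, define $$\zeta_{\mathrm i}=\hat{\mathbf h}_{\mathrm i}^{\mathrm H}\mathbf R^{-1}\hat{\mathbf h}_{\mathrm i}-\frac{\rho_{\bar{\mathrm i}}\varepsilon_{\mathbf v}\hat{\mathbf h}_{\mathrm i}^{\mathrm H}\mathbf R^{-1}\hat{\mathbf h}_{\bar{\mathrm i}}\hat{\mathbf h}_{\bar{\mathrm i}}^{\mathrm H}\mathbf R^{-1}\hat{\mathbf h}_{\mathrm i}}{1+\rho_{\bar{\mathrm i}}\varepsilon_{\mathbf v}\hat{\mathbf h}_{\bar{\mathrm i}}^{\mathrm H}\mathbf R^{-1}\hat{\mathbf h}_{\bar{\mathrm i}}},\qquad \mathcal R_{\mathrm{erg},\mathrm i}=\mathbb E\left[\log_2\left(1+\frac{\rho_{\mathrm i}\varepsilon_{\mathbf v}\varepsilon_{u,\mathrm i}\zeta_{\mathrm i}}{1+\rho_{\mathrm i}\varepsilon_{\mathbf v}(1-\varepsilon_{u,\mathrm i})\zeta_{\mathrm i}}\right)\right],$$ and let $$\eta_{\mathrm i}=\frac{\varrho_{\mathbf A_{\mathrm i}}\varrho_{\mathbf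 g_{\mathrm i}}\big(\kappa_{\mathbf A_{\mathrm i}}\kappa_{\mathbf g_{\mathrm i}}N_{\mathrm i}^2+(1+\kappa_{\mathbf g_{\mathrm i}}+\kappa_{\mathbf A_{\mathrm i}})N_{\mathrm i}\big)}{(1+\kappa_{\mathbf A_{\mathrm i}})(1+\kappa_{\mathbf g_{\mathrm i}})}+\varrho_{\mathbf b_{\mathrm i}}.$$ Then the ergodic spectral efficiency satisfies $\mathcal R_{\mathrm{erg},\mathrm i}\le\ddot{\mathcal R}'_{\mathrm{erg},\mathrm i}$ (a loose upper bound), where $$\ddot{\mathcal R}'_{\mathrm{erg},\mathrm i}=\log_2\left(1+\frac{\rho_{\mathrm i}\varepsilon_{\mathbf v}\varepsilon_{u,\mathrm i}M\eta_{\mathrm i}}{\rho_{\mathrm i}\varepsilon_{\mathbf v}(1-\varepsilon_{u,\mathrm i})M\eta_{\mathrm i}+\rho_{\mathrm r}(1-\varepsilon_{\mathbf v})\eta_{\mathrm r}+\rho_{\mathrm t}(1-\varepsilon_{\mathbf v})\eta_{\mathrm t}+\sigma_w^2}\right).$$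
   Context: System: an access point (AP) with $M$ antennas forming a uniform linear array with spacing $d_0$ (wavelength $\lambda$) serves two single-antenna users indexed $\mathrm i\in\{\mathrm r,\mathrm t\}$. An intelligent omni-surface (IOS) has $N_{\mathrm r}=N_{\mathrm r}^xN_{\mathrm r}^y$ elements serving user $\mathrm r$ and $N_{\mathrm t}=N_{\mathrm t}^xN_{\mathrm t}^y$ elements serving user $\mathrm t$, with element spacings $\delta_x,\delta_y$. The deterministic phase-shift matrices are $\mathbf\Theta_{\mathrm i}=\mathrm{diag}(e^{\jmath\theta_{\mathrm i,1}},\dots,e^{\jmath\theta_{\mathrm i,N_{\mathrm i}}})$, $\theta_{\mathrm i,n}\in[0,2\pi)$, where $\jmath=\sqrt{-1}$. Constants: path losses $\varrho_{\mathbf A_{\mathrm i}},\varrho_{\mathbf g_{\mathrm i}},\varrho_{\mathbf b_{\mathrm i}}>0$, Rician factors $\kappa_{\mathbf A_{\mathrm i}},\kappa_{\mathbf g_{\mathrm i}}\ge0$, deterministic angles $\phi_{\mathrm i},\varphi_{\mathrm i},\omega_{\mathrm i},\varpi_{\mathrm i},\psi_{\mathrm i}$. Deterministic vectors: $\overline{\mathbf g}_{\mathrm i}\in\mathbb C^{N_{\mathrm i}}$ has the entry indexed by $(n_x,n_y)$, $n_x\in\{0,\dots,N_{\mathrm i}^x-1\}$, $n_y\in\{0,\dots,N_{\mathrm i}^y-1\}$, equal to $\exp\big(\jmath\frac{2\pi}{\lambda}(\delta_xn_x\sin\phi_{\mathrm i}\cos\varphi_{\mathrm i}+\delta_yn_y\cos\phi_{\mathrm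 i})\big)$; $\overline{\mathbf a}^{(\mathrm{IOS})}_{\mathrm i}\in\mathbb C^{N_{\mathrm i}}$ is defined in the same way (same indexing) with $(\omega_{\mathrm i},\varpi_{\mathrm i})$ in place of $(\phi_{\mathrm i},\varphi_{\mathrm i})$; $\overline{\mathbf a}^{(\mathrm{AP})}_{\mathrm i}\in\mathbb C^M$ has $m$-th entry $\exp(\jmath\frac{2\pi}{\lambda}d_0(m-1)\cos\psi_{\mathrm i})$; $\overline{\mathbf A}_{\mathrm i}=\overline{\mathbf a}^{(\mathrm{AP})}_{\mathrm i}\overline{\mathbf a}^{(\mathrm{IOS})\mathrm H}_{\mathrm i}$. Random channels: $\mathbf b_{\mathrm i}\sim\mathcal{CN}(\mathbf 0,\mathbf I_M)$; $\mathbf g_{\mathrm i}=\sqrt{\kappa_{\mathbf g_{\mathrm i}}/(1+\kappa_{\mathbf g_{\mathrm i}})}\,\overline{\mathbf g}_{\mathrm i}+\sqrt{1/(1+\kappa_{\mathbf g_{\mathrm i}})}\,\widetilde{\mathbf g}_{\mathrm i}$ with $\widetilde{\mathbf g}_{\mathrm i}\sim\mathcal{CN}(\mathbf 0,\mathbf I_{N_{\mathrm i}})$; $\mathbf A_{\mathrm i}=\sqrt{\kappa_{\mathbf A_{\mathrm i}}/(1+\kappa_{\mathbf A_{\mathrm i}})}\,\overline{\mathbf A}_{\mathrm i}+\sqrt{1/(1+\kappa_{\mathbf A_{\mathrm i}})}\,\widetilde{\mathbf A}_{\mathrm i}$ where $\widetilde{\mathbf A}_{\mathrm i}\in\mathbb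 C^{M\times N_{\mathrm i}}$ has i.i.d. $\mathcal{CN}(0,1)$ entries; all of $\mathbf b_{\mathrm r},\mathbf b_{\mathrm t},\widetilde{\mathbf g}_{\mathrm r},\widetilde{\mathbf g}_{\mathrm t},\widetilde{\mathbf A}_{\mathrm r},\widetilde{\mathbf A}_{\mathrm t}$ are mutually independent. Equivalent channel: $\mathbf h_{\mathrm i}=\sqrt{\varrho_{\mathbf A_{\mathrm i}}\varrho_{\mathbf g_{\mathrm i}}}\mathbf A_{\mathrm i}\mathbf\Theta_{\mathrm i}\mathbf g_{\mathrm i}+\sqrt{\varrho_{\mathbf b_{\mathrm i}}}\mathbf b_{\mathrm i}$, with mean $\overline{\mathbf h}_{\mathrm i}=\mathbb E[\mathbf h_{\mathrm i}]$. Below $\mathbf C_{\mathbf x\mathbf y}=\mathbb E[(\mathbf x-\mathbb E\mathbf x)(\mathbf y-\mathbb E\mathbf y)^{\mathrm H}]$ computed under this model. Channel estimation with hardware impairments: hardware quality factors $\varepsilon_{\mathbf v},\varepsilon_{u,\mathrm r},\varepsilon_{u,\mathrm t}\in[0,1]$, transmit powers $\rho_{\mathrm r},\rho_{\mathrm t}>0$, noise variance $\sigma_w^2>0$, pilot length $K\ge1$. The processed pilot observation for user $\mathrm r$ is $\mathbf x_{\mathrm r}=\sqrt{K\rho_{\mathrm r}\varepsilon_{\mathbf v}\varepsilon_{u,\mathrm r}}\mathbf h_{\mathrm r}+\sqrt{\rho_{\mathrm r}\varepsilon_{\mathbf v}(1-\varepsilon_{u,\mathrm r})}\mathbf h_{\mathrm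 r}u_{\mathrm r}+\sqrt{\rho_{\mathrm t}\varepsilon_{\mathbf v}(1-\varepsilon_{u,\mathrm t})}\mathbf h_{\mathrm t}u_{\mathrm t}+\sqrt{\rho_{\mathrm r}(1-\varepsilon_{\mathbf v})}\mathbf h_{\mathrm r}\odot\mathbf v_{\mathrm r}+\sqrt{\rho_{\mathrm t}(1-\varepsilon_{\mathbf v})}\mathbf h_{\mathrm t}\odot\mathbf v_{\mathrm t}+\mathbf w$, where $u_{\mathrm r},u_{\mathrm t}\sim\mathcal{CN}(0,1)$, $\mathbf v_{\mathrm r},\mathbf v_{\mathrm t}\sim\mathcal{CN}(\mathbf 0,\mathbf I_M)$, $\mathbf w\sim\mathcal{CN}(\mathbf 0,\sigma_w^2\mathbf I_M)$ are independent of each other and of the channels ($\odot$ = entrywise product); $\mathbf x_{\mathrm t}$ is defined symmetrically (roles of $\mathrm r$ and $\mathrm t$ swapped, with fresh independent impairment and noise variables). The LMMSE estimates are $\hat{\mathbf h}_{\mathrm i}=\overline{\mathbf h}_{\mathrm i}+\mathbf C_{\mathbf h_{\mathrm i}\mathbf x_{\mathrm i}}\mathbf C_{\mathbf x_{\mathrm i}\mathbf x_{\mathrm i}}^{-1}(\mathbf x_{\mathrm i}-\mathbb E[\mathbf x_{\mathrm i}])$, with $\mathbf C_{\hat{\mathbf h}_{\mathrm i}\hat{\mathbf h}_{\mathrm i}}=\mathbf C_{\mathbf h_{\mathrm i}\mathbf x_{\mathrm i}}\mathbf C_{\mathbf x_{\mathrm i}\mathbf x_{\mathrm i}}^{-1}\mathbf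 C_{\mathbf h_{\mathrm i}\mathbf x_{\mathrm i}}^{\mathrm H}$ and error covariance $\mathbf C_{\check{\mathbf h}_{\mathrm i}\check{\mathbf h}_{\mathrm i}}=\mathbf C_{\mathbf h_{\mathrm i}\mathbf h_{\mathrm i}}-\mathbf C_{\hat{\mathbf h}_{\mathrm i}\hat{\mathbf h}_{\mathrm i}}$. The matrix $\mathbf R\in\mathbb C^{M\times M}$ is $\mathbf R=\rho_{\mathrm r}\varepsilon_{\mathbf v}(1-\varepsilon_{u,\mathrm r})\mathbf C_{\check{\mathbf h}_{\mathrm r}\check{\mathbf h}_{\mathrm r}}+\rho_{\mathrm t}\varepsilon_{\mathbf v}(1-\varepsilon_{u,\mathrm t})\mathbf C_{\check{\mathbf h}_{\mathrm t}\check{\mathbf h}_{\mathrm t}}+\sum_{\mathrm i\in\{\mathrm r,\mathrm t\}}\rho_{\mathrm i}(1-\varepsilon_{\mathbf v})\Big(\varrho_{\mathbf A_{\mathrm i}}\varrho_{\mathbf g_{\mathrm i}}\frac{(1+\kappa_{\mathbf g_{\mathrm i}}+\kappa_{\mathbf A_{\mathrm i}})N_{\mathrm i}}{(1+\kappa_{\mathbf A_{\mathrm i}})(1+\kappa_{\mathbf g_{\mathrm i}})}+\varrho_{\mathbf b_{\mathrm i}}+\varrho_{\mathbf A_{\mathrm i}}\varrho_{\mathbf g_{\mathrm i}}\frac{\kappa_{\mathbf A_{\mathrm i}}\kappa_{\mathbf g_{\mathrm i}}|\overline{\mathbf a}^{(\mathrm{IOS})\mathrm H}_{\mathrm i}\mathbf\Theta_{\mathrm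 i}\overline{\mathbf g}_{\mathrm i}|^2}{(1+\kappa_{\mathbf A_{\mathrm i}})(1+\kappa_{\mathbf g_{\mathrm i}})}\Big)\mathbf I_M+\sigma_w^2\mathbf I_M.$ *)

theory Defs
  imports "HOL-Probability.Probability"
begin

datatype usr = Ur | Ut

fun oth :: "usr \<Rightarrow> usr" where
  "oth Ur = Ut" | "oth Ut = Ur"

text \<open>Every elementary scalar random variable of the model is a standard circularly symmetric
complex Gaussian CN(0,1) indexed by a label:
  LB i m          : entry m of b_i
  LG i (nx,ny)    : entry (nx,ny) of the NLOS part of g_i
  LA i m (nx,ny)  : entry (m,(nx,ny)) of the NLOS part of A_i
  LU j i          : u_i occurring in the observation x_j
  LV j i m        : entry m of v_i occurring in the observation x_j
  LW j m          : entry m of the (normalised) noise w in observation x_j.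
AP antenna indices are 0-based: m in {0..<M}.\<close>

datatype lbl = LB usr nat | LG usr "nat \<times> nat" | LA usr nat "nat \<times> nat"
  | LU usr usr | LV usr usr nat | LW usr nat

record params =
  lam :: real          \<comment> \<open>wavelength\<close>
  d0 :: real           \<comment> \<open>AP antenna spacing\<close>
  dx :: real           \<comment> \<open>IOS element spacing delta_x\<close>
  dy :: real           \<comment> \<open>IOS element spacing delta_y\<close>
  Mant :: nat          \<comment> \<open>number M of AP antennas\<close>
  Nx :: "usr \<Rightarrow> nat"
  Ny :: "usr \<Rightarrow> nat"
  theta :: "usr \<Rightarrow> nat \<times> nat \<Rightarrow> real"   \<comment> \<open>IOS phase shifts\<close>
  rA :: "usr \<Rightarrow> real"  \<comment> \<open>path loss varrho_A\<close>
  rg :: "usr \<Rightarrow> real"  \<comment> \<open>path loss varrho_g\<close>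
  rb :: "usr \<Rightarrow> real"  \<comment> \<open>path loss varrho_b\<close>
  kA :: "usr \<Rightarrow> real"  \<comment> \<open>Rician factor kappa_A\<close>
  kg :: "usr \<Rightarrow> real"  \<comment> \<open>Rician factor kappa_g\<close>
  phi :: "usr \<Rightarrow> real"
  vphi :: "usr \<Rightarrow> real"
  om :: "usr \<Rightarrow> real"
  vom :: "usr \<Rightarrow> real"
  psi :: "usr \<Rightarrow> real"
  epsv :: real
  epsu :: "usr \<Rightarrow> real"
  pw :: "usr \<Rightarrow> real"  \<comment> \<open>transmit powers rho_i\<close>
  sw2 :: real          \<comment> \<open>noise variance sigma_w^2\<close>
  Kp :: nat            \<comment> \<open>pilot length K\<close>

definition ios :: "params \<Rightarrow> usr \<Rightarrow> (nat \<times> nat) set" where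
  "ios p i = {0..<Nx p i} \<times> {0..<Ny p i}"

definition Nios :: "params \<Rightarrow> usr \<Rightarrow> nat" where
  "Nios p i = Nx p i * Ny p i"

definition labels :: "params \<Rightarrow> lbl set" where
  "labels p = {LB i m | i m. m < Mant p}
     \<union> {LG i n | i n. n \<in> ios p i}
     \<union> {LA i m n | i m n. m < Mant p \<and> n \<in> ios p i}
     \<union> {LU j i | j i. True}
     \<union> {LV j i m | j i m. m < Mant p}
     \<union> {LW j m | j m. m < Mant p}"

text \<open>A family Z of complex random variables indexed by L whose real and imaginary parts are
all mutually independent N(0,1/2) real random variables, i.e. Z l are i.i.d. CN(0,1).\<close>

definition std_cgauss_family :: "'w measure \<Rightarrow> ('l \<Rightarrow> 'w \<Rightarrow> complex) \<Rightarrow> 'l set \<Rightarrow> bool" where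
  "std_cgauss_family P Z L \<longleftrightarrow>
     prob_space.indep_vars P (\<lambda>_. borel)
       (\<lambda>(l, b). if b then (\<lambda>w. Re (Z l w)) else (\<lambda>w. Im (Z l w))) (L \<times> UNIV)
   \<and> (\<forall>l\<in>L. distributed P lborel (\<lambda>w. Re (Z l w)) (\<lambda>x. ennreal (normal_density 0 (sqrt (1/2)) x))
           \<and> distributed P lborel (\<lambda>w. Im (Z l w)) (\<lambda>x. ennreal (normal_density 0 (sqrt (1/2)) x)))"

definition mmul :: "nat \<Rightarrow> (nat \<Rightarrow> nat \<Rightarrow> complex) \<Rightarrow> (nat \<Rightarrow> nat \<Rightarrow> complex) \<Rightarrow> nat \<Rightarrow> nat \<Rightarrow> complex" where
  "mmul n A B = (\<lambda>i j. \<Sum>k<n. A i k * B k j)"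

definition mvmul :: "nat \<Rightarrow> (nat \<Rightarrow> nat \<Rightarrow> complex) \<Rightarrow> (nat \<Rightarrow> complex) \<Rightarrow> nat \<Rightarrow> complex" where
  "mvmul n A x = (\<lambda>i. \<Sum>k<n. A i k * x k)"

definition hadj :: "(nat \<Rightarrow> nat \<Rightarrow> complex) \<Rightarrow> nat \<Rightarrow> nat \<Rightarrow> complex" where
  "hadj A = (\<lambda>i j. cnj (A j i))"

definition is_inv :: "nat \<Rightarrow> (nat \<Rightarrow> nat \<Rightarrow> complex) \<Rightarrow> (nat \<Rightarrow> nat \<Rightarrow> complex) \<Rightarrow> bool" where
  "is_inv n A B \<longleftrightarrow> (\<forall>i j. (n \<le> i \<or> n \<le> j) \<longrightarrow> B i j = 0)
     \<and> (\<forall>i<n. \<forall>j<n. mmul n A B i j = (if i = j then 1 else 0))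
     \<and> (\<forall>i<n. \<forall>j<n. mmul n B A i j = (if i = j then 1 else 0))"

text \<open>Inverse of the n x n matrix (restriction of A to {0..<n}^2); unique when it exists.\<close>
definition minv :: "nat \<Rightarrow> (nat \<Rightarrow> nat \<Rightarrow> complex) \<Rightarrow> nat \<Rightarrow> nat \<Rightarrow> complex" where
  "minv n A = (THE B. is_inv n A B)"

definition hform :: "nat \<Rightarrow> (nat \<Rightarrow> complex) \<Rightarrow> (nat \<Rightarrow> nat \<Rightarrow> complex) \<Rightarrow> (nat \<Rightarrow> complex) \<Rightarrow> complex" where
  "hform n x A y = (\<Sum>a<n. \<Sum>b<n. cnj (x a) * A a b * y b)"

definition Ex :: "'w measure \<Rightarrow> ('w \<Rightarrow> 'b::{banach,second_countable_topology}) \<Rightarrow> 'b" where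
  "Ex P f = integral\<^sup>L P f"

definition meanv :: "'w measure \<Rightarrow> ('w \<Rightarrow> nat \<Rightarrow> complex) \<Rightarrow> nat \<Rightarrow> complex" where
  "meanv P X = (\<lambda>i. Ex P (\<lambda>w. X w i))"

definition cov :: "'w measure \<Rightarrow> ('w \<Rightarrow> nat \<Rightarrow> complex) \<Rightarrow> ('w \<Rightarrow> nat \<Rightarrow> complex) \<Rightarrow> nat \<Rightarrow> nat \<Rightarrow> complex" where
  "cov P X Y = (\<lambda>i j. Ex P (\<lambda>w. (X w i - meanv P X i) * cnj (Y w j - meanv P Y j)))"

definition gbar :: "params \<Rightarrow> usr \<Rightarrow> nat \<times> nat \<Rightarrow> complex" where
  "gbar p i n = exp (\<i> * complex_of_real (2 * pi / lam p *
      (dx p * real (fst n) * sin (phi p i) * cos (vphi p i) + dy p * real (snd n) * cos (phi p i))))"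

definition aios :: "params \<Rightarrow> usr \<Rightarrow> nat \<times> nat \<Rightarrow> complex" where
  "aios p i n = exp (\<i> * complex_of_real (2 * pi / lam p *
      (dx p * real (fst n) * sin (om p i) * cos (vom p i) + dy p * real (snd n) * cos (om p i))))"

text \<open>0-based antenna index m corresponds to the paper's m+1.\<close>
definition aap :: "params \<Rightarrow> usr \<Rightarrow> nat \<Rightarrow> complex" where
  "aap p i m = exp (\<i> * complex_of_real (2 * pi / lam p * d0 p * real m * cos (psi p i)))"

definition Abar :: "params \<Rightarrow> usr \<Rightarrow> nat \<Rightarrow> nat \<times> nat \<Rightarrow> complex" where
  "Abar p i m n = aap p i m * cnj (aios p i n)"

definition bil :: "params \<Rightarrow> usr \<Rightarrow> complex" where
  "bil p i = (\<Sum>n\<in>ios p i. cnj (aios p i n) * cis (theta p i n) * gbar p i n)"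

definition gch :: "params \<Rightarrow> (lbl \<Rightarrow> 'w \<Rightarrow> complex) \<Rightarrow> usr \<Rightarrow> 'w \<Rightarrow> nat \<times> nat \<Rightarrow> complex" where
  "gch p Z i w n = of_real (sqrt (kg p i / (1 + kg p i))) * gbar p i n
                 + of_real (sqrt (1 / (1 + kg p i))) * Z (LG i n) w"

definition Ach :: "params \<Rightarrow> (lbl \<Rightarrow> 'w \<Rightarrow> complex) \<Rightarrow> usr \<Rightarrow> 'w \<Rightarrow> nat \<Rightarrow> nat \<times> nat \<Rightarrow> complex" where
  "Ach p Z i w m n = of_real (sqrt (kA p i / (1 + kA p i))) * Abar p i m n
                   + of_real (sqrt (1 / (1 + kA p i))) * Z (LA i m n) w"

definition hch :: "params \<Rightarrow> (lbl \<Rightarrow> 'w \<Rightarrow> complex) \<Rightarrow> usr \<Rightarrow> 'w \<Rightarrow> nat \<Rightarrow> complex" where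
  "hch p Z i w m = of_real (sqrt (rA p i * rg p i)) *
        (\<Sum>n\<in>ios p i. Ach p Z i w m n * cis (theta p i n) * gch p Z i w n)
      + of_real (sqrt (rb p i)) * Z (LB i m) w"

text \<open>Processed pilot observation x_i (x_r as in the paper; x_t symmetric with fresh variables).\<close>
definition xobs :: "params \<Rightarrow> (lbl \<Rightarrow> 'w \<Rightarrow> complex) \<Rightarrow> usr \<Rightarrow> 'w \<Rightarrow> nat \<Rightarrow> complex" where
  "xobs p Z i w m =
      of_real (sqrt (real (Kp p) * pw p i * epsv p * epsu p i)) * hch p Z i w m
    + of_real (sqrt (pw p i * epsv p * (1 - epsu p i))) * hch p Z i w m * Z (LU i i) w
    + of_real (sqrt (pw p (oth i) * epsv p * (1 - epsu p (oth i)))) * hch p Z (oth i) w m * Z (LU i (oth i)) w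
    + of_real (sqrt (pw p i * (1 - epsv p))) * hch p Z i w m * Z (LV i i m) w
    + of_real (sqrt (pw p (oth i) * (1 - epsv p))) * hch p Z (oth i) w m * Z (LV i (oth i) m) w
    + of_real (sqrt (sw2 p)) * Z (LW i m) w"

definition hhat :: "params \<Rightarrow> 'w measure \<Rightarrow> (lbl \<Rightarrow> 'w \<Rightarrow> complex) \<Rightarrow> usr \<Rightarrow> 'w \<Rightarrow> nat \<Rightarrow> complex" where
  "hhat p P Z i w =
     (let M = Mant p; h = hch p Z i; x = xobs p Z i;
          W = mmul M (cov P h x) (minv M (cov P x x))
      in (\<lambda>m. meanv P h m + mvmul M W (\<lambda>k. x w k - meanv P x k) m))"

definition Cerr :: "params \<Rightarrow> 'w measure \<Rightarrow> (lbl \<Rightarrow> 'w \<Rightarrow> complex) \<Rightarrow> usr \<Rightarrow> nat \<Rightarrow> nat \<Rightarrow> complex" where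
  "Cerr p P Z i =
     (let M = Mant p; h = hch p Z i; x = xobs p Z i
      in (\<lambda>a b. cov P h h a b
            - mmul M (mmul M (cov P h x) (minv M (cov P x x))) (hadj (cov P h x)) a b))"

definition Rmat :: "params \<Rightarrow> 'w measure \<Rightarrow> (lbl \<Rightarrow> 'w \<Rightarrow> complex) \<Rightarrow> nat \<Rightarrow> nat \<Rightarrow> complex" where
  "Rmat p P Z = (\<lambda>a b.
       of_real (pw p Ur * epsv p * (1 - epsu p Ur)) * Cerr p P Z Ur a b
     + of_real (pw p Ut * epsv p * (1 - epsu p Ut)) * Cerr p P Z Ut a b
     + (if a = b then of_real
          ((\<Sum>i\<in>{Ur, Ut}. pw p i * (1 - epsv p) *
              (rA p i * rg p i * (1 + kg p i + kA p i) * real (Nios p i) / ((1 + kA p i) * (1 + kg p i))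
               + rb p i
               + rA p i * rg p i * kA p i * kg p i * (cmod (bil p i))\<^sup>2 / ((1 + kA p i) * (1 + kg p i))))
           + sw2 p)
        else 0))"

definition zeta :: "params \<Rightarrow> 'w measure \<Rightarrow> (lbl \<Rightarrow> 'w \<Rightarrow> complex) \<Rightarrow> usr \<Rightarrow> 'w \<Rightarrow> complex" where
  "zeta p P Z i w =
     (let M = Mant p; Ri = minv M (Rmat p P Z); j = oth i;
          hi = hhat p P Z i w; hj = hhat p P Z j w;
          c = of_real (pw p j * epsv p)
      in hform M hi Ri hi - c * hform M hi Ri hj * hform M hj Ri hi / (1 + c * hform M hj Ri hj))"

definition Rerg :: "params \<Rightarrow> 'w measure \<Rightarrow> (lbl \<Rightarrow> 'w \<Rightarrow> complex) \<Rightarrow> usr \<Rightarrow> real" where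
  "Rerg p P Z i = Ex P (\<lambda>w. log 2 (1 +
        pw p i * epsv p * epsu p i * Re (zeta p P Z i w)
        / (1 + pw p i * epsv p * (1 - epsu p i) * Re (zeta p P Z i w))))"

definition eta :: "params \<Rightarrow> usr \<Rightarrow> real" where
  "eta p i = rA p i * rg p i * (kA p i * kg p i * (real (Nios p i))\<^sup>2 + (1 + kg p i + kA p i) * real (Nios p i))
             / ((1 + kA p i) * (1 + kg p i)) + rb p i"

definition Rbound :: "params \<Rightarrow> usr \<Rightarrow> real" where
  "Rbound p i = log 2 (1 + pw p i * epsv p * epsu p i * real (Mant p) * eta p i
      / (pw p i * epsv p * (1 - epsu p i) * real (Mant p) * eta p i
         + pw p Ur * (1 - epsv p) * eta p Ur + pw p Ut * (1 - epsv p) * eta p Ut + sw2 p))"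

end

theory Submission
  imports Defs "Jordan_Normal_Form.Determinant"
begin

text \<open>
  The error covariances are Gram matrices of the LMMSE errors, hence positive semidefinite, so
  \<open>R\<close> dominates \<open>s I\<close> with \<open>s = \<rho>\<^sub>r (1 - \<epsilon>\<^sub>v) \<eta>\<^sub>r + \<rho>\<^sub>t (1 - \<epsilon>\<^sub>v) \<eta>\<^sub>t + \<sigma>\<^sup>2\<close>. Therefore
  \<open>0 \<le> \<zeta>\<^sub>i \<le> |h'|\<^sup>2 / s\<close> for the estimate \<open>h'\<close> of \<open>h\<^sub>i\<close>. The estimation error is orthogonal
  to \<open>h'\<close>, so \<open>E |h'|\<^sup>2 \<le> E |h\<^sub>i|\<^sup>2 = M \<eta>\<^sub>i\<close>. The rate is an increasing concave function of \<open>\<zeta>\<^sub>i\<close>;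
  bounding it by its tangent at \<open>M \<eta>\<^sub>i / s\<close> gives the claim.
\<close>

subsection \<open>Coercive Hermitian matrices\<close>

lemma mvmul_mmul: "mvmul n (mmul n A B) x = mvmul n A (mvmul n B x)"
proof
  fix i
  have "mvmul n (mmul n A B) x i = (\<Sum>k<n. \<Sum>l<n. A i l * B l k * x k)"
    by (simp add: mvmul_def mmul_def sum_distrib_right)
  also have "\<dots> = (\<Sum>l<n. \<Sum>k<n. A i l * B l k * x k)"
    by (rule sum.swap)
  also have "\<dots> = mvmul n A (mvmul n B x) i"
    by (simp add: mvmul_def sum_distrib_left mult.assoc)
  finally show "mvmul n (mmul n A B) x i = mvmul n A (mvmul n B x) i" .
qed

lemma mvmul_identity:
  assumes "\<And>i j. i < n \<Longrightarrow> j < n \<Longrightarrow> A i j = (if i = j then 1 else 0)" "i < n"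
  shows "mvmul n A x i = x i"
proof -
  have "mvmul n A x i = (\<Sum>k<n. if k = i then x k else 0)"
    unfolding mvmul_def by (rule sum.cong) (use assms in auto)
  then show ?thesis using assms(2) by simp
qed

text \<open>\<open>B = B (A C) = (B A) C = C\<close> inside the block, and outside it both inverses
  are zero by the convention in \<open>is_inv\<close>. This makes the description in
  \<open>minv\<close> well defined.\<close>

lemma is_inv_unique:
  assumes B: "is_inv n A B" and C: "is_inv n A C"
  shows "B = C"
proof (intro ext)
  fix i j
  show "B i j = C i j"
  proof (cases "i < n \<and> j < n")
    case True
    have "B i j = mvmul n B (mvmul n A (\<lambda>k. C k j)) i"
    proof -
      have "mvmul n B (mvmul n A (\<lambda>k. C k j)) i = (\<Sum>k<n. B i k * mmul n A C k j)"
        by (simp add: mvmul_def mmul_def)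
      also have "\<dots> = (\<Sum>k<n. if k = j then B i k else 0)"
        by (rule sum.cong) (use C True in \<open>auto simp: is_inv_def\<close>)
      finally show ?thesis using True by simp
    qed
    also have "\<dots> = mvmul n (mmul n B A) (\<lambda>k. C k j) i"
      by (simp add: mvmul_mmul)
    also have "\<dots> = C i j"
      by (rule mvmul_identity) (use B True in \<open>auto simp: is_inv_def\<close>)
    finally show ?thesis .
  next
    case False
    then show ?thesis using B C by (auto simp: is_inv_def not_less)
  qed
qed

text \<open>A trivial kernel forces a nonzero determinant of the carrier matrix \<open>A'\<close>.
  Its two-sided inverse is then carried back and padded with zeros, as \<open>is_inv\<close>
  demands.\<close>

lemma is_inv_minv:
  assumes inj: "\<And>x. (\<And>i. i < n \<Longrightarrow> mvmul n A x i = 0) \<Longrightarrow> (\<And>i. i < n \<Longrightarrow> x i = 0)"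
  shows "is_inv n A (minv n A)"
proof -
  define A' where "A' = mat n n (\<lambda>(i, j). A i j)"
  have A': "A' \<in> carrier_mat n n" by (simp add: A'_def)
  have "det A' \<noteq> 0"
  proof
    assume "det A' = 0"
    then obtain v where v: "v \<in> carrier_vec n" "v \<noteq> 0\<^sub>v n" "A' *\<^sub>v v = 0\<^sub>v n"
      using det_0_iff_vec_prod_zero_field[OF A'] by blast
    have "mvmul n A (vec_index v) i = 0" if "i < n" for i
    proof -
      have "vec_index (A' *\<^sub>v v) i = mvmul n A (vec_index v) i"
        using that v(1) by (simp add: A'_def mvmul_def scalar_prod_def lessThan_atLeast0)
      then show ?thesis using v(3) that by simp
    qed
    then have "\<And>i. i < n \<Longrightarrow> vec_index v i = 0" using inj[of "vec_index v"] by blast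
    then have "v = 0\<^sub>v n" using v(1) by (intro eq_vecI) auto
    with v(2) show False by simp
  qed
  then have "A' \<in> Units (ring_mat TYPE(complex) n ())"
    by (rule det_non_zero_imp_unit[OF A'])
  then obtain B' where B': "B' \<in> carrier_mat n n" "A' * B' = 1\<^sub>m n" "B' * A' = 1\<^sub>m n"
    by (auto simp: Units_def ring_mat_def)
  define B where "B = (\<lambda>i j. if i < n \<and> j < n then B' $$ (i, j) else 0)"
  have "mmul n A B i j = (A' * B') $$ (i, j)" "mmul n B A i j = (B' * A') $$ (i, j)"
    if "i < n" "j < n" for i j
    using that B'(1)
    by (auto simp: A'_def B_def mmul_def times_mat_def scalar_prod_def lessThan_atLeast0
        intro!: sum.cong)
  then have "is_inv n A B"
    using B' by (auto simp: is_inv_def B_def)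
  then show ?thesis
    unfolding minv_def by (metis is_inv_unique theI)
qed

lemma mvmul_inverse:
  assumes "is_inv n A B" "i < n"
  shows "mvmul n A (mvmul n B x) i = x i" "mvmul n B (mvmul n A x) i = x i"
  unfolding mvmul_mmul[symmetric] using assms
  by (simp_all add: is_inv_def mvmul_identity)

lemma hform_mvmul: "hform n x A y = (\<Sum>a<n. cnj (x a) * mvmul n A y a)"
  by (simp add: hform_def mvmul_def sum_distrib_left mult.assoc)

lemma cnj_hform:
  assumes "\<And>a b. a < n \<Longrightarrow> b < n \<Longrightarrow> A b a = cnj (A a b)"
  shows "cnj (hform n x A y) = hform n y A x"
proof -
  have "cnj (hform n x A y) = (\<Sum>a<n. \<Sum>b<n. cnj (y b) * A b a * x a)"
    unfolding hform_def cnj_sum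
  proof (intro sum.cong refl)
    fix a b assume "a \<in> {..<n}" "b \<in> {..<n}"
    then have "A b a = cnj (A a b)" by (intro assms) auto
    then show "cnj (cnj (x a) * A a b * y b) = cnj (y b) * A b a * x a"
      by (simp add: mult_ac)
  qed
  also have "\<dots> = hform n y A x" unfolding hform_def by (rule sum.swap)
  finally show ?thesis .
qed

text \<open>Expansion for completing the square in \<open>schur_nonneg\<close>.\<close>

lemma hform_diff_scaled:
  "hform n (\<lambda>a. x a - t * y a) A (\<lambda>a. x a - t * y a) =
     hform n x A x - t * hform n x A y - cnj t * hform n y A x + cnj t * t * hform n y A y"
  unfolding hform_def sum_distrib_left sum_subtractf[symmetric] sum.distrib[symmetric]
  by (intro sum.cong refl) (simp add: algebra_simps)

text \<open>The Loewner bound \<open>A\<close> \<ge> \<open>s\<close> I, expressed through the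
  quadratic form. It is used for the pilot covariance with \<open>s\<close> the noise variance, and
  for \<open>Rmat\<close> with \<open>s\<close> the noise floor.\<close>

locale coercive =
  fixes n :: nat and A :: "nat \<Rightarrow> nat \<Rightarrow> complex" and s :: real
  assumes s_pos: "s > 0"
    and hermitian: "\<And>a b. a < n \<Longrightarrow> b < n \<Longrightarrow> A b a = cnj (A a b)"
    and coercive: "\<And>x. Re (hform n x A x) \<ge> s * (\<Sum>a<n. (cmod (x a))\<^sup>2)"
begin

text \<open>The form vanishes on a kernel vector, so coercivity makes the norm of that vector
  zero.\<close>

lemma is_inv_minv: "is_inv n A (minv n A)"
proof (rule is_inv_minv)
  fix x i assume z: "\<And>i. i < n \<Longrightarrow> mvmul n A x i = 0" and i: "i < n"
  have "hform n x A x = 0" by (simp add: hform_mvmul z)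
  with coercive[of x] have "s * (\<Sum>a<n. (cmod (x a))\<^sup>2) \<le> 0" by simp
  with s_pos have "(\<Sum>a<n. (cmod (x a))\<^sup>2) \<le> 0" by (simp add: mult_le_0_iff)
  then have "(\<Sum>a<n. (cmod (x a))\<^sup>2) = 0" by (simp add: sum_nonneg order_antisym)
  then show "x i = 0" using i by (subst (asm) sum_nonneg_eq_0_iff) auto
qed

text \<open>With u and v the images of \<open>x\<close> and \<open>y\<close> under the inverse,
  \<open>x\<close> = A u and A is Hermitian, so both sides equal u^H A v. Symmetry and positivity of
  the inverse are inherited from A in this way.\<close>

lemma hform_minv:
  "hform n x (minv n A) y = hform n (mvmul n (minv n A) x) A (mvmul n (minv n A) y)"
proof -
  let ?x = "mvmul n (minv n A) x" and ?y = "mvmul n (minv n A) y"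
  have "cnj (hform n ?y A ?x) = (\<Sum>a<n. cnj (x a) * ?y a)"
    unfolding hform_mvmul[of n ?y A] cnj_sum
    by (intro sum.cong refl) (simp add: mvmul_inverse(1)[OF is_inv_minv] mult.commute)
  also have "\<dots> = hform n x (minv n A) y" by (simp add: hform_mvmul)
  finally show ?thesis by (simp add: cnj_hform[OF hermitian])
qed

lemma cnj_hform_minv: "cnj (hform n x (minv n A) y) = hform n y (minv n A) x"
  by (simp add: hform_minv cnj_hform[OF hermitian])

lemma hform_minv_real: "hform n x (minv n A) x = of_real (Re (hform n x (minv n A) x))"
  using cnj_hform_minv[of x x] by (simp add: complex_eq_iff)

lemma hform_minv_nonneg: "0 \<le> Re (hform n x (minv n A) x)"
  unfolding hform_minv
  by (rule order_trans[OF _ coercive]) (use s_pos in \<open>auto intro!: mult_nonneg_nonneg sum_nonneg\<close>)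

text \<open>Let y be the image of \<open>x\<close> under the inverse and q the form. Expanding |x -
  s y|^2 \<ge> 0 gives 2 s q \<le> |x|^2 + s^2 |y|^2, and coercivity at y gives s |y|^2 \<le>
  q.\<close>

lemma hform_minv_le: "Re (hform n x (minv n A) x) \<le> (\<Sum>a<n. (cmod (x a))\<^sup>2) / s"
proof -
  let ?y = "mvmul n (minv n A) x"
  let ?q = "Re (hform n x (minv n A) x)"
  have q: "?q = (\<Sum>a<n. Re (cnj (x a) * ?y a))" by (simp add: hform_mvmul)
  have "(cmod (x a - s * ?y a))\<^sup>2 = (cmod (x a))\<^sup>2 - 2 * s * Re (cnj (x a) * ?y a) + s\<^sup>2 * (cmod (?y a))\<^sup>2" for a
    by (simp only: cmod_power2) (simp add: power2_eq_square algebra_simps)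
  then have "(\<Sum>a<n. (cmod (x a - s * ?y a))\<^sup>2) =
      (\<Sum>a<n. (cmod (x a))\<^sup>2) - 2 * s * ?q + s\<^sup>2 * (\<Sum>a<n. (cmod (?y a))\<^sup>2)"
    unfolding q by (simp only: sum.distrib sum_subtractf sum_distrib_left)
  moreover have "0 \<le> (\<Sum>a<n. (cmod (x a - s * ?y a))\<^sup>2)" by (intro sum_nonneg) simp
  moreover have "s * (s * (\<Sum>a<n. (cmod (?y a))\<^sup>2)) \<le> s * ?q"
    by (rule mult_left_mono) (use coercive[of ?y] s_pos in \<open>simp_all add: hform_minv\<close>)
  ultimately have "s * ?q \<le> (\<Sum>a<n. (cmod (x a))\<^sup>2)"
    by (simp add: power2_eq_square mult.assoc)
  then show ?thesis using s_pos by (simp add: field_simps)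
qed

section \<open>Rank-one correction of an inverse form\<close>

context
  fixes x y :: "nat \<Rightarrow> complex" and c :: real and \<zeta> :: complex
  assumes c: "c \<ge> 0"
    and zeta: "\<zeta> = hform n x (minv n A) x - of_real c * hform n x (minv n A) y * hform n y (minv n A) x
      / (1 + of_real c * hform n y (minv n A) y)"
begin

text \<open>By the Sherman-Morrison formula \<zeta> is the form of (A + c y y^H)^{-1} at
  \<open>x\<close>. The subtracted term is c |r|^2 / (1 + c q) with q real and nonnegative, so
  dropping it only increases the value.\<close>

lemma schur_le: "Re \<zeta> \<le> Re (hform n x (minv n A) x)"
proof -
  define q where "q = Re (hform n y (minv n A) y)"
  define r where "r = hform n y (minv n A) x"
  have r': "hform n x (minv n A) y = cnj r" by (simp add: r_def cnj_hform_minv)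
  have q: "hform n y (minv n A) y = of_real q" unfolding q_def by (rule hform_minv_real)
  have "\<zeta> = hform n x (minv n A) x - of_real (c * (cmod r)\<^sup>2 / (1 + c * q))"
    unfolding zeta r' q r_def[symmetric] of_real_divide of_real_mult[of c] complex_norm_square
    by (simp add: mult_ac)
  moreover have "0 \<le> c * (cmod r)\<^sup>2 / (1 + c * q)"
    using c hform_minv_nonneg[of y] by (simp add: q_def)
  ultimately show ?thesis by simp
qed

text \<open>Completing the square: \<open>\<zeta>\<close> is the form at \<open>x - c t y\<close> plus \<open>c |t|\<^sup>2\<close>.\<close>

lemma schur_nonneg: "0 \<le> Re \<zeta>"
proof -
  define q where "q = Re (hform n y (minv n A) y)"
  define r where "r = hform n y (minv n A) x"
  define D where "D = 1 + complex_of_real c * of_real q"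
  \<comment> \<open>This \<open>t\<close> minimises the form at x - c t y plus c |t|^2, and \<zeta>
    is the minimum.\<close>
  define t where "t = r / D"
  have r': "hform n x (minv n A) y = cnj r" by (simp add: r_def cnj_hform_minv)
  have q: "hform n y (minv n A) y = of_real q" unfolding q_def by (rule hform_minv_real)
  have "0 \<le> q" by (simp add: q_def hform_minv_nonneg)
  then have D: "D = of_real (1 + c * q)" "1 + c * q > 0"
    using c by (auto simp: D_def intro: add_pos_nonneg)
  have D0: "D \<noteq> 0" "cnj D = D" using D by (auto simp del: of_real_add)
  have "hform n (\<lambda>a. x a - (of_real c * t) * y a) (minv n A) (\<lambda>a. x a - (of_real c * t) * y a)
      + of_real (c * (cmod t)\<^sup>2)
    = hform n x (minv n A) x - of_real c * t * cnj r - of_real c * cnj t * r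
      + of_real c * cnj t * t * (1 + of_real c * of_real q)"
    unfolding hform_diff_scaled by (simp add: r' q complex_norm_square algebra_simps del: of_real_power flip: r_def)
  also have "of_real c * cnj t * t * (1 + of_real c * of_real q) = of_real c * cnj t * r"
    using D0 by (simp add: t_def flip: D_def)
  also have "hform n x (minv n A) x - of_real c * t * cnj r - of_real c * cnj t * r + of_real c * cnj t * r = \<zeta>"
    by (simp add: zeta r' q t_def flip: r_def D_def)
  finally have "Re \<zeta> = Re (hform n (\<lambda>a. x a - (of_real c * t) * y a) (minv n A) (\<lambda>a. x a - (of_real c * t) * y a))
      + c * (cmod t)\<^sup>2" by (metis Re_complex_of_real plus_complex.sel(1))
  then show ?thesis
    using hform_minv_nonneg[of "\<lambda>a. x a - (of_real c * t) * y a"] c by simp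
qed

end

end

lemma hform_cong:
  "(\<And>a b. a < n \<Longrightarrow> b < n \<Longrightarrow> A a b = B a b) \<Longrightarrow> hform n x A y = hform n x B y"
  by (simp add: hform_def)

text \<open>A positive semidefinite term cannot lower the bound \<open>s\<close>. The error
  covariances enter \<open>Rmat\<close> as such terms.\<close>

lemma coercive_add_scaled:
  assumes A: "coercive n A s" and c: "c \<ge> 0"
    and herm: "\<And>a b. a < n \<Longrightarrow> b < n \<Longrightarrow> B b a = cnj (B a b)"
    and psd: "\<And>x. Re (hform n x B x) \<ge> 0"
  shows "coercive n (\<lambda>a b. of_real c * B a b + A a b) s"
proof
  interpret coercive n A s by fact
  show "s > 0" by (rule s_pos)
  show "of_real c * B b a + A b a = cnj (of_real c * B a b + A a b)" if "a < n" "b < n" for a b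
    using hermitian[OF that] herm[OF that] by (simp only: complex_cnj_add complex_cnj_mult complex_cnj_complex_of_real)
  show "Re (hform n x (\<lambda>a b. of_real c * B a b + A a b) x) \<ge> s * (\<Sum>a<n. (cmod (x a))\<^sup>2)" for x
  proof -
    have "hform n x (\<lambda>a b. of_real c * B a b + A a b) x = of_real c * hform n x B x + hform n x A x"
      unfolding hform_def sum_distrib_left sum.distrib[symmetric]
      by (intro sum.cong refl) (simp add: algebra_simps)
    then show ?thesis using coercive[of x] mult_nonneg_nonneg[OF c psd[of x]] by simp
  qed
qed

lemma coercive_scaled_identity:
  assumes "s > 0"
  shows "coercive n (\<lambda>a b. if a = b then of_real s else 0) s"
proof
  show "s * (\<Sum>a<n. (cmod (x a))\<^sup>2) \<le> Re (hform n x (\<lambda>a b. if a = b then of_real s else 0) x)" for x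
  proof -
    have "hform n x (\<lambda>a b. if a = b then of_real s else 0) x =
        (\<Sum>a<n. \<Sum>b<n. if b = a then of_real s * (x a * cnj (x a)) else 0)"
      unfolding hform_def by (intro sum.cong refl) auto
    also have "\<dots> = (\<Sum>a<n. of_real s * (x a * cnj (x a)))" by simp
    also have "\<dots> = of_real (s * (\<Sum>a<n. (cmod (x a))\<^sup>2))"
      by (simp add: complex_norm_square sum_distrib_left del: of_real_power)
    finally show ?thesis by simp
  qed
qed (use assms in auto)

subsection \<open>Concavity of the rate function\<close>

text \<open>The function is the logarithm of (1 + (a + b) z) / (1 + b z), and the coefficient of
  \<open>z - z0\<close> is its derivative at \<open>z0\<close>. The bound comes from ln t \<le> t -
  1 applied to the ratio of the values at \<open>z\<close> and \<open>z0\<close>.\<close>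

lemma rate_tangent:
  fixes a b z z0 :: real
  assumes "a \<ge> 0" "b \<ge> 0" "z \<ge> 0" "z0 \<ge> 0"
  shows "log 2 (1 + a * z / (1 + b * z)) \<le>
     log 2 (1 + a * z0 / (1 + b * z0)) + a / ((1 + b * z0) * (1 + (a + b) * z0) * ln 2) * (z - z0)"
proof -
  let ?B = "\<lambda>z. 1 + b * z" and ?C = "\<lambda>z. 1 + (a + b) * z"
  have pos: "?B z > 0" "?B z0 > 0" "?C z > 0" "?C z0 > 0"
    using assms by (auto intro!: add_pos_nonneg mult_nonneg_nonneg)
  have eq: "1 + a * u / (1 + b * u) = ?C u / ?B u" if "?B u > 0" for u
    using that by (simp add: field_simps)
  have "ln (?C z / ?B z) - ln (?C z0 / ?B z0) = ln ((?C z / ?B z) / (?C z0 / ?B z0))"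
    using pos by (subst ln_div[of "?C z / ?B z"]) auto
  also have "\<dots> \<le> (?C z / ?B z) / (?C z0 / ?B z0) - 1"
    by (rule ln_le_minus_one) (use pos in simp)
  also have "\<dots> = a * (z - z0) / (?B z * ?C z0)"
    using pos by (simp add: divide_simps) (simp add: algebra_simps)
  \<comment> \<open>Replacing \<open>?B z\<close> by \<open>?B z0\<close> shrinks the denominator
    when \<open>z - z0\<close> is nonnegative and enlarges it when \<open>z - z0\<close> is
    negative. Both changes increase the quotient.\<close>
  also have "\<dots> \<le> a * (z - z0) / (?B z0 * ?C z0)"
  proof (cases "z \<ge> z0")
    case True
    then show ?thesis using pos assms
      by (intro divide_left_mono mult_right_mono mult_pos_pos mult_nonneg_nonneg) (auto intro: mult_left_mono)
  next
    case False
    have "a * (z0 - z) / (?B z0 * ?C z0) \<le> a * (z0 - z) / (?B z * ?C z0)"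
      using pos assms False
      by (intro divide_left_mono mult_right_mono mult_pos_pos mult_nonneg_nonneg) (auto intro: mult_left_mono)
    then show ?thesis by (simp add: divide_simps algebra_simps split: if_splits)
  qed
  finally have "ln (?C z / ?B z) \<le> ln (?C z0 / ?B z0) + a * (z - z0) / (?B z0 * ?C z0)" by simp
  then have "ln (?C z / ?B z) / ln 2 \<le> (ln (?C z0 / ?B z0) + a * (z - z0) / (?B z0 * ?C z0)) / ln 2"
    by (rule divide_right_mono) simp
  then show ?thesis
    using pos by (simp add: eq log_def add_divide_distrib)
qed

text \<open>After clearing denominators the mixed terms a b z z' cancel and a z \<le> a z'
  remains.\<close>

lemma rate_mono:
  fixes a b z z' :: real
  assumes "a \<ge> 0" "b \<ge> 0" "0 \<le> z" "z \<le> z'"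
  shows "log 2 (1 + a * z / (1 + b * z)) \<le> log 2 (1 + a * z' / (1 + b * z'))"
proof -
  have pos: "1 + b * z > 0" "1 + b * z' > 0"
    using assms by (auto intro!: add_pos_nonneg mult_nonneg_nonneg)
  have "a * z / (1 + b * z) \<le> a * z' / (1 + b * z')"
    using pos mult_left_mono[OF assms(4,1)] by (simp add: divide_simps algebra_simps)
  moreover have "0 \<le> a * z / (1 + b * z)" using pos assms by simp
  ultimately show ?thesis by simp
qed

subsection \<open>Random variables with finite moments and LMMSE estimation\<close>

context prob_space
begin

text \<open>All absolute moments are required because this class is closed under products. The
  observations contain products of three Gaussians, and covariances multiply two
  observations.\<close>

definition mom :: "('a \<Rightarrow> complex) \<Rightarrow> bool" where
  "mom f \<longleftrightarrow> f \<in> borel_measurable M \<and> (\<forall>k. integrable M (\<lambda>w. cmod (f w) ^ k))"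

lemma mom_measurable: "mom f \<Longrightarrow> f \<in> borel_measurable M"
  by (simp add: mom_def)

lemma mom_integrable:
  assumes "mom f"
  shows "integrable M f"
proof (rule integrable_norm_cancel)
  have "integrable M (\<lambda>w. cmod (f w) ^ 1)" using assms unfolding mom_def by blast
  then show "integrable M (\<lambda>w. cmod (f w))" by simp
qed (rule mom_measurable[OF assms])

lemma mom_integrable_norm2: "mom f \<Longrightarrow> integrable M (\<lambda>w. (cmod (f w))\<^sup>2)"
  by (simp add: mom_def)

lemma mom_const: "mom (\<lambda>w. c)"
  by (simp add: mom_def)

lemma mom_cnj: "mom f \<Longrightarrow> mom (\<lambda>w. cnj (f w))"
  by (auto simp: mom_def intro: borel_measurable_continuous_on[OF continuous_on_cnj])

text \<open>The sum is at most twice the larger modulus, and the \<open>k\<close>-th power of a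
  maximum is at most the sum of the \<open>k\<close>-th powers.\<close>

lemma mom_add:
  assumes "mom f" "mom g"
  shows "mom (\<lambda>w. f w + g w)"
  unfolding mom_def
proof (intro conjI allI)
  show m: "(\<lambda>w. f w + g w) \<in> borel_measurable M"
    using assms unfolding mom_def by (intro borel_measurable_add) auto
  fix k
  have "(cmod (f w + g w)) ^ k \<le> 2 ^ k * (cmod (f w) ^ k + cmod (g w) ^ k)" for w
  proof -
    let ?m = "max (cmod (f w)) (cmod (g w))"
    have "cmod (f w + g w) \<le> 2 * ?m"
      using norm_triangle_ineq[of "f w" "g w"] by linarith
    then have "cmod (f w + g w) ^ k \<le> (2 * ?m) ^ k" by (rule power_mono) simp
    also have "\<dots> \<le> 2 ^ k * (cmod (f w) ^ k + cmod (g w) ^ k)"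
      unfolding power_mult_distrib by (rule mult_left_mono) (auto simp: max_def)
    finally show ?thesis .
  qed
  then have bound: "AE w in M. norm (cmod (f w + g w) ^ k) \<le> norm (2 ^ k * (cmod (f w) ^ k + cmod (g w) ^ k))"
    by simp
  have "integrable M (\<lambda>w. cmod (f w) ^ k)" "integrable M (\<lambda>w. cmod (g w) ^ k)"
    using assms unfolding mom_def by blast+
  then have "integrable M (\<lambda>w. 2 ^ k * (cmod (f w) ^ k + cmod (g w) ^ k))"
    by simp
  then show "integrable M (\<lambda>w. cmod (f w + g w) ^ k)"
    by (rule Bochner_Integration.integrable_bound[OF _ _ bound]) (use m in measurable)
qed

text \<open>The inequality 2 u v \<le> u^2 + v^2 bounds the \<open>k\<close>-th moment of a product
  by the moments of order \<open>2 * k\<close> of the factors.\<close>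

lemma mom_mult:
  assumes "mom f" "mom g"
  shows "mom (\<lambda>w. f w * g w)"
  unfolding mom_def
proof (intro conjI allI)
  show m: "(\<lambda>w. f w * g w) \<in> borel_measurable M"
    using assms unfolding mom_def by (intro borel_measurable_times) auto
  fix k
  have "(cmod (f w * g w)) ^ k \<le> cmod (f w) ^ (2 * k) + cmod (g w) ^ (2 * k)" for w
  proof -
    have "2 * (cmod (f w) ^ k * cmod (g w) ^ k) \<le> (cmod (f w) ^ k)\<^sup>2 + (cmod (g w) ^ k)\<^sup>2"
      using sum_squares_bound[of "cmod (f w) ^ k" "cmod (g w) ^ k"] by simp
    moreover have "0 \<le> cmod (f w) ^ k * cmod (g w) ^ k" by simp
    ultimately show ?thesis
      unfolding norm_mult power_mult_distrib power_even_eq by linarith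
  qed
  then have bound: "AE w in M. norm (cmod (f w * g w) ^ k) \<le> norm (cmod (f w) ^ (2 * k) + cmod (g w) ^ (2 * k))"
    by simp
  have "integrable M (\<lambda>w. cmod (f w) ^ (2 * k))" "integrable M (\<lambda>w. cmod (g w) ^ (2 * k))"
    using assms unfolding mom_def by blast+
  then have "integrable M (\<lambda>w. cmod (f w) ^ (2 * k) + cmod (g w) ^ (2 * k))"
    by simp
  then show "integrable M (\<lambda>w. cmod (f w * g w) ^ k)"
    by (rule Bochner_Integration.integrable_bound[OF _ _ bound]) (use m in measurable)
qed

lemma mom_diff: "mom f \<Longrightarrow> mom g \<Longrightarrow> mom (\<lambda>w. f w - g w)"
  using mom_add[of f "\<lambda>w. (- 1) * g w"] mom_mult[OF mom_const, of g "- 1"] by simp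

lemma mom_sum: "(\<And>a. a \<in> I \<Longrightarrow> mom (f a)) \<Longrightarrow> mom (\<lambda>w. \<Sum>a\<in>I. f a w)"
  by (induction I rule: infinite_finite_induct) (auto intro: mom_const mom_add)

lemmas mom_intros = mom_const mom_cnj mom_add mom_mult mom_diff mom_sum

lemma expectation_mult_cnj_self:
  "expectation (\<lambda>w. f w * cnj (f w)) = of_real (expectation (\<lambda>w. (cmod (f w))\<^sup>2))"
  by (simp add: complex_norm_square[symmetric] del: of_real_power)

lemma expectation_mult_cnj_commute:
  "expectation (\<lambda>w. f w * cnj (g w)) = cnj (expectation (\<lambda>w. g w * cnj (f w)))"
proof -
  have "cnj (expectation (\<lambda>w. g w * cnj (f w))) = expectation (\<lambda>w. cnj (g w * cnj (f w)))"
    by (rule Bochner_Integration.integral_cnj[symmetric])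
  also have "\<dots> = expectation (\<lambda>w. f w * cnj (g w))"
    by (simp only: complex_cnj_mult complex_cnj_cnj mult.commute)
  finally show ?thesis by (rule sym)
qed

lemma expectation_diff_sum_mult:
  assumes "mom f" "mom g" "\<And>k. k \<in> I \<Longrightarrow> mom (x k)"
  shows "expectation (\<lambda>w. (f w - (\<Sum>k\<in>I. c k * x k w)) * g w) =
    expectation (\<lambda>w. f w * g w) - (\<Sum>k\<in>I. c k * expectation (\<lambda>w. x k w * g w))"
proof -
  have "(\<lambda>w. (f w - (\<Sum>k\<in>I. c k * x k w)) * g w) = (\<lambda>w. f w * g w - (\<Sum>k\<in>I. c k * (x k w * g w)))"
    by (simp add: left_diff_distrib sum_distrib_right mult.assoc)
  then show ?thesis
    using assms by (simp add: mom_integrable mom_intros)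
qed

lemma expectation_double_sum:
  assumes "\<And>a b. a \<in> I \<Longrightarrow> b \<in> I \<Longrightarrow> mom (F a b)"
  shows "expectation (\<lambda>w. \<Sum>a\<in>I. \<Sum>b\<in>I. c a b * F a b w) = (\<Sum>a\<in>I. \<Sum>b\<in>I. c a b * expectation (F a b))"
proof -
  have "expectation (\<lambda>w. \<Sum>a\<in>I. \<Sum>b\<in>I. c a b * F a b w) = (\<Sum>a\<in>I. expectation (\<lambda>w. \<Sum>b\<in>I. c a b * F a b w))"
    by (rule Bochner_Integration.integral_sum) (intro mom_integrable mom_intros assms)
  also have "\<dots> = (\<Sum>a\<in>I. \<Sum>b\<in>I. expectation (\<lambda>w. c a b * F a b w))"
    by (intro sum.cong refl Bochner_Integration.integral_sum mom_integrable mom_intros assms)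
  finally show ?thesis by simp
qed

lemma expectation_norm2_add_orthogonal:
  assumes "mom f" "mom g" "expectation (\<lambda>w. f w * cnj (g w)) = 0"
  shows "expectation (\<lambda>w. (cmod (f w + g w))\<^sup>2) =
    expectation (\<lambda>w. (cmod (f w))\<^sup>2) + expectation (\<lambda>w. (cmod (g w))\<^sup>2)"
proof -
  have "(cmod (f w + g w))\<^sup>2 = (cmod (f w))\<^sup>2 + (cmod (g w))\<^sup>2 + 2 * Re (f w * cnj (g w))" for w
    unfolding cmod_power2 by (simp add: power2_eq_square algebra_simps)
  moreover have "integrable M (\<lambda>w. f w * cnj (g w))"
    using assms by (intro mom_integrable mom_intros)
  moreover have "expectation (\<lambda>w. Re (f w * cnj (g w))) = Re (expectation (\<lambda>w. f w * cnj (g w)))"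
    using calculation(2) by (rule integral_Re)
  ultimately show ?thesis
    using assms by (simp add: mom_integrable_norm2 del: times_complex.sel)
qed

text \<open>v^H E[e e^H] v = E |v^H e|^2. Positivity of every covariance below rests on this
  identity.\<close>

lemma hform_gram:
  assumes "\<And>a. a < n \<Longrightarrow> mom (e a)"
  shows "hform n v (\<lambda>a b. expectation (\<lambda>w. e a w * cnj (e b w))) v =
    of_real (expectation (\<lambda>w. (cmod (\<Sum>a<n. cnj (v a) * e a w))\<^sup>2))"
proof -
  have "of_real (expectation (\<lambda>w. (cmod (\<Sum>a<n. cnj (v a) * e a w))\<^sup>2)) =
    expectation (\<lambda>w. \<Sum>a<n. \<Sum>b<n. cnj (v a) * v b * (e a w * cnj (e b w)))"
    unfolding expectation_mult_cnj_self[symmetric] cnj_sum sum_product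
    by (simp add: mult_ac)
  also have "\<dots> = (\<Sum>a<n. \<Sum>b<n. cnj (v a) * v b * expectation (\<lambda>w. e a w * cnj (e b w)))"
    using assms by (intro expectation_double_sum mom_intros) auto
  finally show ?thesis by (simp add: hform_def mult_ac)
qed

section \<open>Covariances and the LMMSE estimate\<close>

lemma cov_eq: "cov M X Y a b = expectation (\<lambda>w. (X w a - meanv M X a) * cnj (Y w b - meanv M Y b))"
  by (simp add: cov_def Ex_def)

lemma cov_hermitian: "cov M X X b a = cnj (cov M X X a b)"
  unfolding cov_eq by (rule expectation_mult_cnj_commute)

lemma expectation_centred:
  assumes "mom (\<lambda>w. X w a)"
  shows "expectation (\<lambda>w. X w a - meanv M X a) = 0"
  using mom_integrable[OF assms] by (simp add: meanv_def Ex_def prob_space)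

context
  fixes n :: nat and h x :: "'a \<Rightarrow> nat \<Rightarrow> complex" and B W :: "nat \<Rightarrow> nat \<Rightarrow> complex"
    and est err :: "'a \<Rightarrow> nat \<Rightarrow> complex"
  assumes mom_h: "\<And>a. a < n \<Longrightarrow> mom (\<lambda>w. h w a)"
    and mom_x: "\<And>a. a < n \<Longrightarrow> mom (\<lambda>w. x w a)"
    and inv: "is_inv n (cov M x x) B"
    and W: "W = mmul n (cov M h x) B"
    and est: "est = (\<lambda>w a. meanv M h a + mvmul n W (\<lambda>k. x w k - meanv M x k) a)"
    and err: "err = (\<lambda>w a. h w a - est w a)"
begin

lemma err_eq: "err w a = (h w a - meanv M h a) - (\<Sum>k<n. W a k * (x w k - meanv M x k))"
  by (simp add: err est mvmul_def)

lemma mom_est: "mom (\<lambda>w. est w a)"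
  using mom_x by (auto simp: est mvmul_def intro!: mom_intros)

lemma mom_err: "a < n \<Longrightarrow> mom (\<lambda>w. err w a)"
  using mom_h mom_est by (auto simp: err intro!: mom_intros)

text \<open>The normal equations W C_xx = C_hx, valid since \<open>B\<close> is a left inverse of
  C_xx.\<close>

lemma W_cov:
  assumes "l < n"
  shows "(\<Sum>k<n. W a k * cov M x x k l) = cov M h x a l"
proof -
  have "(\<Sum>k<n. W a k * cov M x x k l) = (\<Sum>k<n. \<Sum>j<n. cov M h x a j * (B j k * cov M x x k l))"
    by (simp add: W mmul_def sum_distrib_right mult.assoc)
  also have "\<dots> = (\<Sum>j<n. cov M h x a j * mmul n B (cov M x x) j l)"
    by (subst sum.swap) (simp add: mmul_def sum_distrib_left)
  also have "\<dots> = (\<Sum>j<n. if j = l then cov M h x a j else 0)"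
    by (rule sum.cong) (use inv assms in \<open>auto simp: is_inv_def\<close>)
  finally show ?thesis using assms by simp
qed

text \<open>Serves four choices of \<open>g\<close>: the constant 1, and the conjugates of the
  centred observation, of the error and of the centred channel.\<close>

lemma expectation_err_mult:
  assumes "a < n" "mom g"
  shows "expectation (\<lambda>w. err w a * g w) = expectation (\<lambda>w. (h w a - meanv M h a) * g w)
    - (\<Sum>k<n. W a k * expectation (\<lambda>w. (x w k - meanv M x k) * g w))"
  unfolding err_eq using assms mom_h mom_x
  by (intro expectation_diff_sum_mult) (auto intro!: mom_intros)

text \<open>The normal equations, read as orthogonality of the error to the centred
  observation.\<close>

lemma err_orthogonal:
  assumes "a < n" "l < n"
  shows "expectation (\<lambda>w. err w a * cnj (x w l - meanv M x l)) = 0"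
proof -
  have "expectation (\<lambda>w. err w a * cnj (x w l - meanv M x l))
      = cov M h x a l - (\<Sum>k<n. W a k * cov M x x k l)"
    unfolding cov_eq by (rule expectation_err_mult) (use assms mom_x in \<open>auto intro!: mom_intros\<close>)
  then show ?thesis by (simp add: W_cov assms)
qed

lemma expectation_err:
  assumes "a < n"
  shows "expectation (\<lambda>w. err w a) = 0"
  using expectation_err_mult[OF assms mom_const[of 1]] mom_h[OF assms] mom_x
  by (simp add: expectation_centred)

text \<open>By orthogonality one of the two error factors may be replaced by the centred channel,
  and expanding the other gives the right-hand side. Hence the error covariance is a Gram
  matrix.\<close>

lemma cov_err:
  assumes "a < n" "b < n"
  shows "expectation (\<lambda>w. err w a * cnj (err w b)) =
    cov M h h a b - mmul n W (hadj (cov M h x)) a b"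
proof -
  have "expectation (\<lambda>w. err w b * cnj (err w a)) = expectation (\<lambda>w. (h w b - meanv M h b) * cnj (err w a))"
    using assms mom_err
    by (subst expectation_err_mult)
       (auto intro!: mom_intros simp: expectation_mult_cnj_commute[of "\<lambda>w. x w _ - meanv M x _"] err_orthogonal
         simp del: complex_cnj_diff)
  then have "expectation (\<lambda>w. err w a * cnj (err w b)) = expectation (\<lambda>w. err w a * cnj (h w b - meanv M h b))"
    by (metis expectation_mult_cnj_commute)
  also have "\<dots> = cov M h h a b - (\<Sum>k<n. W a k * expectation (\<lambda>w. (x w k - meanv M x k) * cnj (h w b - meanv M h b)))"
    unfolding cov_eq by (rule expectation_err_mult) (use assms mom_h in \<open>auto intro!: mom_intros\<close>)
  also have "\<dots> = cov M h h a b - mmul n W (hadj (cov M h x)) a b"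
    unfolding mmul_def hadj_def cov_eq
    by (subst (2) expectation_mult_cnj_commute) simp
  finally show ?thesis .
qed

text \<open>Pythagoras for h = est + err. The estimate is a constant plus a combination of centred
  observations, and the error is centred and orthogonal to those observations.\<close>

lemma expectation_norm2_est_le:
  assumes "a < n"
  shows "expectation (\<lambda>w. (cmod (est w a))\<^sup>2) \<le> expectation (\<lambda>w. (cmod (h w a))\<^sup>2)"
proof -
  \<comment> \<open>The negated weights give the shape of \<open>expectation_diff_sum_mult\<close>,
    with the constant mean as its first function.\<close>
  have est': "est w a = meanv M h a - (\<Sum>k<n. (- W a k) * (x w k - meanv M x k))" for w
    by (simp add: est mvmul_def sum_negf)
  have "expectation (\<lambda>w. est w a * cnj (err w a)) =
    expectation (\<lambda>w. meanv M h a * cnj (err w a))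
      - (\<Sum>k<n. (- W a k) * expectation (\<lambda>w. (x w k - meanv M x k) * cnj (err w a)))"
    unfolding est' by (rule expectation_diff_sum_mult) (use assms mom_x mom_err in \<open>auto intro!: mom_intros\<close>)
  also have "\<dots> = 0"
    using assms
    by (simp add: expectation_err expectation_mult_cnj_commute[of "\<lambda>w. x w _ - meanv M x _"] err_orthogonal
         del: complex_cnj_diff)
  finally have "expectation (\<lambda>w. (cmod (est w a + err w a))\<^sup>2) =
      expectation (\<lambda>w. (cmod (est w a))\<^sup>2) + expectation (\<lambda>w. (cmod (err w a))\<^sup>2)"
    by (intro expectation_norm2_add_orthogonal mom_est mom_err assms)
  moreover have "0 \<le> expectation (\<lambda>w. (cmod (err w a))\<^sup>2)" by simp
  moreover have "est w a + err w a = h w a" for w by (simp add: err)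
  ultimately show ?thesis by simp
qed

end

end

section \<open>Families of independent standard complex Gaussians\<close>

locale cgauss = prob_space P for P :: "'w measure" +
  fixes Z :: "'l \<Rightarrow> 'w \<Rightarrow> complex" and L :: "'l set"
  assumes std: "std_cgauss_family P Z L"
begin

definition part :: "'l \<times> bool \<Rightarrow> 'w \<Rightarrow> real" where
  "part = (\<lambda>(l, b). if b then (\<lambda>w. Re (Z l w)) else (\<lambda>w. Im (Z l w)))"

text \<open>The sigma-algebra generated by the variables with labels in \<open>K\<close>.
  Independence is then proved by exhibiting disjoint label sets on which two functions
  depend.\<close>

definition gen :: "'l set \<Rightarrow> 'w measure" where
  "gen K = vimage_algebra (space P) (\<lambda>w. \<lambda>i\<in>K \<times> UNIV. part i w) (PiM (K \<times> UNIV) (\<lambda>_. borel))"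

lemma indep_part: "indep_vars (\<lambda>_. borel) part (L \<times> UNIV)"
  using std by (simp add: std_cgauss_family_def part_def)

lemma space_gen: "space (gen K) = space P"
  by (simp add: gen_def)

lemma part_measurable_gen:
  assumes "l \<in> K"
  shows "part (l, b) \<in> borel_measurable (gen K)"
proof -
  have "(\<lambda>w. \<lambda>i\<in>K \<times> UNIV. part i w) \<in> measurable (gen K) (PiM (K \<times> UNIV) (\<lambda>_. borel))"
    unfolding gen_def by (rule measurable_vimage_algebra1) (auto simp: space_PiM)
  then have "(\<lambda>w. (\<lambda>i\<in>K \<times> UNIV. part i w) (l, b)) \<in> borel_measurable (gen K)"
    by (rule measurable_compose) (use assms in \<open>auto intro!: measurable_component_singleton\<close>)
  then show ?thesis using assms by simp
qed

lemma Z_measurable_gen: "l \<in> K \<Longrightarrow> Z l \<in> borel_measurable (gen K)"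
  using part_measurable_gen[of l K True] part_measurable_gen[of l K False]
  by (simp add: borel_measurable_complex_iff part_def)

lemma sets_gen_le:
  assumes "K \<subseteq> L"
  shows "sets (gen K) \<subseteq> sets P"
  unfolding gen_def
proof (rule sets_image_in_sets)
  show "(\<lambda>w. \<lambda>i\<in>K \<times> UNIV. part i w) \<in> measurable P (PiM (K \<times> UNIV) (\<lambda>_. borel))"
    using indep_part assms by (intro measurable_restrict) (auto simp: indep_vars_def)
qed simp

lemma gen_measurable:
  assumes "K \<subseteq> L" "f \<in> borel_measurable (gen K)"
  shows "f \<in> borel_measurable P"
  using measurable_mono[OF order_refl refl sets_gen_le[OF assms(1)] space_gen, of borel] assms(2)
  by auto

text \<open>Disjoint blocks of an independent family generate independent sigma-algebras, and these
  contain the sigma-algebras generated by \<open>f\<close> and \<open>g\<close>.\<close>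

lemma indep_var_gen:
  fixes f g :: "'w \<Rightarrow> complex"
  assumes K: "K \<subseteq> L" and J: "J \<subseteq> L" and KJ: "K \<inter> J = {}"
    and f: "f \<in> borel_measurable (gen K)" and g: "g \<in> borel_measurable (gen J)"
  shows "indep_var borel f borel g"
proof -
  have "indep_var (PiM (K \<times> UNIV) (\<lambda>_. borel)) (\<lambda>w. \<lambda>i\<in>K \<times> UNIV. part i w)
      (PiM (J \<times> UNIV) (\<lambda>_. borel)) (\<lambda>w. \<lambda>i\<in>J \<times> UNIV. part i w)"
    by (rule indep_var_restrict[OF indep_part]) (use K J KJ in auto)
  then have "indep_set (sets (gen K)) (sets (gen J))"
    unfolding indep_var_eq gen_def sets_vimage_algebra by simp
  moreover have "sigma_sets (space P) {u -` A \<inter> space P | A. A \<in> sets borel} \<subseteq> sets (gen I)"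
    if "u \<in> borel_measurable (gen I)" for u :: "'w \<Rightarrow> complex" and I
    unfolding space_gen[symmetric, of I]
    by (rule sets.sigma_sets_subset) (use that in \<open>auto intro: measurable_sets\<close>)
  ultimately have "indep_set (sigma_sets (space P) {f -` A \<inter> space P | A. A \<in> sets borel})
      (sigma_sets (space P) {g -` A \<inter> space P | A. A \<in> sets borel})"
    using f g unfolding indep_sets2_eq by (meson subset_iff)
  then show ?thesis
    unfolding indep_var_eq using gen_measurable[OF K f] gen_measurable[OF J g] by simp
qed

lemma expectation_mult_indep:
  assumes "K \<subseteq> L" "J \<subseteq> L" "K \<inter> J = {}"
    and "f \<in> borel_measurable (gen K)" "g \<in> borel_measurable (gen J)"
    and "mom f" "mom g"
  shows "expectation (\<lambda>w. f w * g w) = expectation f * expectation g"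
  by (intro indep_var_lebesgue_integral indep_var_gen[OF assms(1-5)] mom_integrable assms(6,7))

lemma part_distributed:
  assumes "l \<in> L"
  shows "distributed P lborel (part (l, b)) (\<lambda>x. ennreal (normal_density 0 (sqrt (1/2)) x))"
  using std assms by (cases b) (auto simp: std_cgauss_family_def part_def)

lemma mom_part:
  assumes "l \<in> L"
  shows "mom (\<lambda>w. of_real (part (l, b) w))"
proof -
  have m: "part (l, b) \<in> borel_measurable P"
    using distributed_measurable[OF part_distributed[OF assms]] by simp
  have "integrable P (\<lambda>w. \<bar>part (l, b) w\<bar> ^ k)" for k
    using integrable_normal_moment_abs[of "sqrt (1/2)" 0 k]
    by (subst distributed_integrable[OF part_distributed[OF assms], symmetric, where g = "\<lambda>x. \<bar>x\<bar> ^ k"]) auto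
  then show ?thesis using m by (simp add: mom_def)
qed

lemma Z_part: "Z l w = of_real (part (l, True) w) + \<i> * of_real (part (l, False) w)"
  by (simp add: part_def complex_eq_iff)

lemma mom_Z:
  assumes "l \<in> L"
  shows "mom (Z l)"
proof -
  have "mom (\<lambda>w. of_real (part (l, True) w) + \<i> * of_real (part (l, False) w))"
    by (intro mom_intros mom_part assms)
  then show ?thesis by (simp add: Z_part[symmetric])
qed

lemma expectation_part:
  assumes "l \<in> L"
  shows "expectation (part (l, b)) = 0"
  \<comment> \<open>The index 0 stands for the moment of order 2 * 0 + 1, the mean.\<close>
  using integral_normal_moment_odd[of "sqrt (1/2)" 0 0]
  by (subst distributed_integral[OF part_distributed[OF assms], symmetric, where g = "\<lambda>x. x"]) auto

lemma expectation_part_square: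
  assumes "l \<in> L"
  shows "expectation (\<lambda>w. (part (l, b) w)\<^sup>2) = 1 / 2"
  using integral_normal_moment_even[of "sqrt (1/2)" 0 1]
  by (subst distributed_integral[OF part_distributed[OF assms], symmetric, where g = "\<lambda>x. x\<^sup>2"]) auto

lemma expectation_Z:
  assumes "l \<in> L"
  shows "expectation (Z l) = 0"
proof -
  have "expectation (Z l) = expectation (\<lambda>w. of_real (part (l, True) w) + \<i> * of_real (part (l, False) w))"
    by (simp add: Z_part[symmetric])
  also have "\<dots> = of_real (expectation (part (l, True))) + \<i> * of_real (expectation (part (l, False)))"
    using mom_integrable[OF mom_part[OF assms]]
    by (subst Bochner_Integration.integral_add) auto
  finally show ?thesis by (simp add: expectation_part assms)
qed

text \<open>On the diagonal the two real variances 1/2 add up to 1. Off it the factors are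
  independent and centred.\<close>

lemma expectation_Z_cnj_Z:
  assumes "l \<in> L" "l' \<in> L"
  shows "expectation (\<lambda>w. Z l w * cnj (Z l' w)) = (if l = l' then 1 else 0)"
proof (cases "l = l'")
  case True
  have "integrable P (\<lambda>w. (part (l, b) w)\<^sup>2)" for b
    using mom_integrable_norm2[OF mom_part[OF assms(1), of b]] by simp
  then have "expectation (\<lambda>w. (part (l, True) w)\<^sup>2 + (part (l, False) w)\<^sup>2) = 1"
    using assms by (simp add: expectation_part_square)
  moreover have "(cmod (Z l w))\<^sup>2 = (part (l, True) w)\<^sup>2 + (part (l, False) w)\<^sup>2" for w
    by (simp add: part_def cmod_power2)
  ultimately show ?thesis
    unfolding True[symmetric] expectation_mult_cnj_self by simp
next
  case False
  have "expectation (\<lambda>w. Z l w * cnj (Z l' w)) = expectation (Z l) * expectation (\<lambda>w. cnj (Z l' w))"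
    using assms False
    by (intro expectation_mult_indep[of "{l}" "{l'}"])
       (auto intro!: mom_cnj mom_Z Z_measurable_gen borel_measurable_continuous_on[OF continuous_on_cnj])
  then show ?thesis using False assms by (simp add: expectation_Z)
qed

lemma expectation_norm2_linear_combination:
  assumes I: "finite I" and inj: "inj_on l I" and l: "l ` I \<subseteq> L"
  shows "expectation (\<lambda>w. (cmod (\<Sum>a\<in>I. c a * Z (l a) w))\<^sup>2) = (\<Sum>a\<in>I. (cmod (c a))\<^sup>2)"
proof -
  have "complex_of_real (expectation (\<lambda>w. (cmod (\<Sum>a\<in>I. c a * Z (l a) w))\<^sup>2)) =
    expectation (\<lambda>w. \<Sum>a\<in>I. \<Sum>b\<in>I. c a * cnj (c b) * (Z (l a) w * cnj (Z (l b) w)))"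
    unfolding expectation_mult_cnj_self[symmetric] cnj_sum sum_product
    by (simp add: mult_ac)
  also have "\<dots> = (\<Sum>a\<in>I. \<Sum>b\<in>I. c a * cnj (c b) * expectation (\<lambda>w. Z (l a) w * cnj (Z (l b) w)))"
    using l by (intro expectation_double_sum mom_intros mom_Z) auto
  also have "\<dots> = (\<Sum>a\<in>I. \<Sum>b\<in>I. if a = b then c a * cnj (c b) else 0)"
    using l inj by (intro sum.cong refl) (auto simp: expectation_Z_cnj_Z inj_on_eq_iff image_subset_iff)
  also have "\<dots> = (\<Sum>a\<in>I. of_real ((cmod (c a))\<^sup>2))"
    using I by (simp add: complex_norm_square del: of_real_power)
  finally show ?thesis unfolding of_real_sum[symmetric] of_real_eq_iff .
qed

text \<open>Rician entries have this shape: a deterministic part \<alpha> plus a Gaussian of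
  amplitude \<beta>.\<close>

lemma expectation_affine_mult_cnj:
  assumes "l \<in> L" "l' \<in> L"
  shows "expectation (\<lambda>w. (\<alpha> + of_real \<beta> * Z l w) * cnj (\<alpha>' + of_real \<beta> * Z l' w)) =
    \<alpha> * cnj \<alpha>' + (if l = l' then of_real (\<beta>\<^sup>2) else 0)"
proof -
  have *: "(\<lambda>w. (\<alpha> + of_real \<beta> * Z l w) * cnj (\<alpha>' + of_real \<beta> * Z l' w)) =
    (\<lambda>w. \<alpha> * cnj \<alpha>' + \<alpha> * of_real \<beta> * cnj (Z l' w) + cnj \<alpha>' * of_real \<beta> * Z l w
      + of_real (\<beta>\<^sup>2) * (Z l w * cnj (Z l' w)))"
    by (simp add: algebra_simps power2_eq_square)
  have "integrable P (\<lambda>w. cnj (Z l' w))" "integrable P (Z l)" "integrable P (\<lambda>w. Z l w * cnj (Z l' w))"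
    using assms by (auto intro!: mom_integrable mom_intros mom_Z)
  then show ?thesis
    unfolding * using assms
    by (simp add: expectation_Z expectation_Z_cnj_Z prob_space)
qed

end

subsection \<open>The channel model\<close>

lemma labels_iff [simp]:
  "LB i m \<in> labels p \<longleftrightarrow> m < Mant p"
  "LG i n \<in> labels p \<longleftrightarrow> n \<in> ios p i"
  "LA i m n \<in> labels p \<longleftrightarrow> m < Mant p \<and> n \<in> ios p i"
  "LU j i \<in> labels p"
  "LV j i m \<in> labels p \<longleftrightarrow> m < Mant p"
  "LW j m \<in> labels p \<longleftrightarrow> m < Mant p"
  by (auto simp: labels_def simp del: split_paired_Ex)

lemma finite_ios [simp]: "finite (ios p i)" and card_ios: "card (ios p i) = Nios p i"
  by (auto simp: ios_def Nios_def)

locale ios_system = cgauss P Z "labels p"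
  for P :: "'w measure" and Z :: "lbl \<Rightarrow> 'w \<Rightarrow> complex" and p :: params +
  assumes epsv: "0 \<le> epsv p" "epsv p \<le> 1"
    and epsu: "0 \<le> epsu p j" "epsu p j \<le> 1"
    and pw: "pw p j > 0"
    and sw2: "sw2 p > 0"
    and rA: "rA p j > 0" and rg: "rg p j > 0" and rb: "rb p j > 0"
    and kA: "kA p j \<ge> 0" and kg: "kg p j \<ge> 0"
    and aligned: "(cmod (bil p j))\<^sup>2 = (real (Nios p j))\<^sup>2"
begin

section \<open>Moments, measurability and mean power of the channels\<close>

lemma mom_gch: "n \<in> ios p i \<Longrightarrow> mom (\<lambda>w. gch p Z i w n)"
  unfolding gch_def by (intro mom_intros mom_Z) simp

lemma mom_Ach: "m < Mant p \<Longrightarrow> n \<in> ios p i \<Longrightarrow> mom (\<lambda>w. Ach p Z i w m n)"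
  unfolding Ach_def by (intro mom_intros mom_Z) simp

lemma mom_hch: "m < Mant p \<Longrightarrow> mom (\<lambda>w. hch p Z i w m)"
  unfolding hch_def by (intro mom_intros mom_Z mom_gch mom_Ach) simp_all

lemma mom_xobs: "m < Mant p \<Longrightarrow> mom (\<lambda>w. xobs p Z i w m)"
  unfolding xobs_def by (intro mom_intros mom_Z mom_hch) simp_all

lemma cnj_measurable:
  "f \<in> borel_measurable N \<Longrightarrow> (\<lambda>w. cnj (f w)) \<in> borel_measurable N"
  by (rule borel_measurable_continuous_on[OF continuous_on_cnj[OF continuous_on_id]])

lemma gch_measurable:
  assumes "LG i n \<in> K"
  shows "(\<lambda>w. gch p Z i w n) \<in> borel_measurable (gen K)"
  unfolding gch_def
  by (intro borel_measurable_add borel_measurable_times borel_measurable_const Z_measurable_gen assms)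

lemma Ach_measurable:
  assumes "LA i m n \<in> K"
  shows "(\<lambda>w. Ach p Z i w m n) \<in> borel_measurable (gen K)"
  unfolding Ach_def
  by (intro borel_measurable_add borel_measurable_times borel_measurable_const Z_measurable_gen assms)

lemma cascade_measurable:
  assumes "\<And>n. n \<in> ios p i \<Longrightarrow> LG i n \<in> K" "\<And>n. n \<in> ios p i \<Longrightarrow> LA i m n \<in> K"
  shows "(\<lambda>w. \<Sum>n\<in>ios p i. Ach p Z i w m n * cis (theta p i n) * gch p Z i w n) \<in> borel_measurable (gen K)"
  by (intro borel_measurable_sum borel_measurable_times borel_measurable_const gch_measurable Ach_measurable assms)

lemma hch_measurable:
  assumes "\<And>n. n \<in> ios p i \<Longrightarrow> LG i n \<in> K" "\<And>n. n \<in> ios p i \<Longrightarrow> LA i m n \<in> K" "LB i m \<in> K"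
  shows "(\<lambda>w. hch p Z i w m) \<in> borel_measurable (gen K)"
  unfolding hch_def
  by (intro borel_measurable_add borel_measurable_times borel_measurable_const cascade_measurable
      Z_measurable_gen assms)

text \<open>In the double sum for the squared modulus the A-factors and g-factors are independent.
  The deterministic parts sum to a multiple of |bil|^2, and the scattered parts contribute on the
  diagonal only.\<close>

lemma expectation_norm2_cascade:
  assumes m: "m < Mant p"
  shows "expectation (\<lambda>w. (cmod (\<Sum>n\<in>ios p i. Ach p Z i w m n * cis (theta p i n) * gch p Z i w n))\<^sup>2) =
    (kA p i * kg p i * (cmod (bil p i))\<^sup>2 + (1 + kg p i + kA p i) * real (Nios p i))
      / ((1 + kA p i) * (1 + kg p i))"
proof -
  \<comment> \<open>Power fractions: \<open>a\<close> and \<open>g\<close> of the deterministic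
    components, \<open>a'\<close> and \<open>g'\<close> of the scattered ones.\<close>
  define a a' g g' where "a = kA p i / (1 + kA p i)" and "a' = 1 / (1 + kA p i)"
    and "g = kg p i / (1 + kg p i)" and "g' = 1 / (1 + kg p i)"
  have pos: "a \<ge> 0" "a' \<ge> 0" "g \<ge> 0" "g' \<ge> 0"
    using kA[of i] kg[of i] by (auto simp: a_def a'_def g_def g'_def)
  define t where "t n = cis (theta p i n)" for n
  define u where "u n = Abar p i m n * t n * gbar p i n" for n
  \<comment> \<open>Excess power of one surface element: (a + a') (g + g') - a g.\<close>
  define d where "d = a * g' + a' * g + a' * g'"
  have unit: "t n * cnj (t n) = 1" "Abar p i m n * cnj (Abar p i m n) = 1" "gbar p i n * cnj (gbar p i n) = 1" for n
    unfolding complex_norm_square[symmetric] t_def Abar_def aap_def aios_def gbar_def norm_mult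
      complex_mod_cnj norm_exp_i_times norm_cis
    by simp_all
  let ?E = "\<lambda>k l. expectation (\<lambda>w. (Ach p Z i w m k * cnj (Ach p Z i w m l)) * (gch p Z i w k * cnj (gch p Z i w l)))"
  have term_eq: "(t k * cnj (t l)) * ?E k l = of_real (a * g) * (u k * cnj (u l)) + (if k = l then of_real d else 0)"
    if k: "k \<in> ios p i" and l: "l \<in> ios p i" for k l
  proof -
    have "?E k l = expectation (\<lambda>w. Ach p Z i w m k * cnj (Ach p Z i w m l)) * expectation (\<lambda>w. gch p Z i w k * cnj (gch p Z i w l))"
      using k l m
      by (intro expectation_mult_indep[where K = "LA i m ` ios p i" and J = "LG i ` ios p i"]
          borel_measurable_times cnj_measurable Ach_measurable gch_measurable mom_intros mom_Ach mom_gch) auto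
    also have "expectation (\<lambda>w. Ach p Z i w m k * cnj (Ach p Z i w m l)) =
        of_real a * (Abar p i m k * cnj (Abar p i m l)) + (if k = l then of_real a' else 0)"
      unfolding Ach_def
      using k l m pos by (subst expectation_affine_mult_cnj)
        (auto simp: mult_ac simp flip: a_def a'_def of_real_mult of_real_power power2_eq_square)
    also have "expectation (\<lambda>w. gch p Z i w k * cnj (gch p Z i w l)) =
        of_real g * (gbar p i k * cnj (gbar p i l)) + (if k = l then of_real g' else 0)"
      unfolding gch_def
      using k l m pos by (subst expectation_affine_mult_cnj)
        (auto simp: mult_ac simp flip: g_def g'_def of_real_mult of_real_power power2_eq_square)
    finally have E: "?E k l = (of_real a * (Abar p i m k * cnj (Abar p i m l)) + (if k = l then of_real a' else 0)) *
        (of_real g * (gbar p i k * cnj (gbar p i l)) + (if k = l then of_real g' else 0))" .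
    show ?thesis
    proof (cases "k = l")
      case True
      have "u l * cnj (u l) = (Abar p i m l * cnj (Abar p i m l)) * (t l * cnj (t l)) * (gbar p i l * cnj (gbar p i l))"
        by (simp add: u_def mult_ac)
      then show ?thesis
        unfolding True E[unfolded True] unit by (simp add: d_def algebra_simps)
    next
      case False
      then show ?thesis unfolding E by (simp add: u_def mult_ac)
    qed
  qed
  have "complex_of_real (expectation (\<lambda>w. (cmod (\<Sum>n\<in>ios p i. Ach p Z i w m n * cis (theta p i n) * gch p Z i w n))\<^sup>2))
    = expectation (\<lambda>w. \<Sum>k\<in>ios p i. \<Sum>l\<in>ios p i. (t k * cnj (t l)) *
        ((Ach p Z i w m k * cnj (Ach p Z i w m l)) * (gch p Z i w k * cnj (gch p Z i w l))))"
    unfolding expectation_mult_cnj_self[symmetric] cnj_sum sum_product t_def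
    by (simp add: mult_ac)
  also have "\<dots> = (\<Sum>k\<in>ios p i. \<Sum>l\<in>ios p i. (t k * cnj (t l)) * ?E k l)"
    using m by (intro expectation_double_sum mom_intros mom_Ach mom_gch) auto
  also have "\<dots> = (\<Sum>k\<in>ios p i. \<Sum>l\<in>ios p i. of_real (a * g) * (u k * cnj (u l)) + (if k = l then of_real d else 0))"
    by (intro sum.cong refl term_eq)
  also have "\<dots> = of_real (a * g) * ((\<Sum>k\<in>ios p i. u k) * cnj (\<Sum>k\<in>ios p i. u k)) + of_nat (Nios p i) * of_real d"
    unfolding sum.distrib cnj_sum sum_product
    unfolding sum_distrib_left by (simp add: card_ios)
  \<comment> \<open>The antenna phase \<open>aap p i m\<close> factors out of the sum. It has
    modulus one, so the result does not depend on \<open>m\<close>.\<close>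
  also have "(\<Sum>k\<in>ios p i. u k) = aap p i m * bil p i"
    by (simp add: u_def t_def bil_def Abar_def sum_distrib_left mult_ac)
  also have "(aap p i m * bil p i) * cnj (aap p i m * bil p i) = of_real ((cmod (bil p i))\<^sup>2)"
    unfolding complex_norm_square[symmetric] norm_mult aap_def norm_exp_i_times by simp
  also have "of_real (a * g) * of_real ((cmod (bil p i))\<^sup>2) + of_nat (Nios p i) * of_real d
    = complex_of_real (a * g * (cmod (bil p i))\<^sup>2 + real (Nios p i) * d)"
    by simp
  finally have "expectation (\<lambda>w. (cmod (\<Sum>n\<in>ios p i. Ach p Z i w m n * cis (theta p i n) * gch p Z i w n))\<^sup>2)
    = a * g * (cmod (bil p i))\<^sup>2 + real (Nios p i) * d"
    unfolding of_real_eq_iff .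
  also have "\<dots> = (kA p i * kg p i * (cmod (bil p i))\<^sup>2 + (1 + kg p i + kA p i) * real (Nios p i))
      / ((1 + kA p i) * (1 + kg p i))"
    using kA[of i] kg[of i] unfolding d_def a_def a'_def g_def g'_def
    by (simp add: divide_simps)
  finally show ?thesis .
qed

text \<open>The direct link is centred and independent of the cascade, so the powers add. The
  alignment assumption turns |bil|^2 into the square of \<open>Nios p i\<close>.\<close>

lemma expectation_norm2_hch:
  assumes m: "m < Mant p"
  shows "expectation (\<lambda>w. (cmod (hch p Z i w m))\<^sup>2) = eta p i"
proof -
  let ?c = "\<lambda>w. \<Sum>n\<in>ios p i. Ach p Z i w m n * cis (theta p i n) * gch p Z i w n"
  let ?f = "\<lambda>w. of_real (sqrt (rA p i * rg p i)) * ?c w"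
  let ?g = "\<lambda>w. of_real (sqrt (rb p i)) * Z (LB i m) w"
  have f: "mom ?f" and g: "mom ?g"
    using m by (auto intro!: mom_intros mom_Ach mom_gch mom_Z)
  have "expectation (\<lambda>w. ?f w * cnj (?g w)) = expectation ?f * expectation (\<lambda>w. cnj (?g w))"
    using m f g
    by (intro expectation_mult_indep[where K = "LA i m ` ios p i \<union> LG i ` ios p i" and J = "{LB i m}"]
        borel_measurable_times borel_measurable_const cnj_measurable cascade_measurable Z_measurable_gen
        mom_cnj) auto
  also have "expectation (\<lambda>w. cnj (?g w)) = 0"
    using m by (simp add: expectation_Z)
  finally have "expectation (\<lambda>w. (cmod (?f w + ?g w))\<^sup>2) =
      expectation (\<lambda>w. (cmod (?f w))\<^sup>2) + expectation (\<lambda>w. (cmod (?g w))\<^sup>2)"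
    using f g by (intro expectation_norm2_add_orthogonal) simp_all
  also have "expectation (\<lambda>w. (cmod (?f w))\<^sup>2) = rA p i * rg p i * expectation (\<lambda>w. (cmod (?c w))\<^sup>2)"
    using rA[of i] rg[of i] by (simp add: norm_mult power_mult_distrib)
  also have "expectation (\<lambda>w. (cmod (?g w))\<^sup>2) = rb p i"
    using expectation_norm2_linear_combination[of "{()}" "\<lambda>_. LB i m" "\<lambda>_. 1"] m rb[of i]
    by (simp add: norm_mult power_mult_distrib)
  finally show ?thesis
    by (simp add: hch_def eta_def expectation_norm2_cascade m aligned)
qed

text \<open>The receiver noise is centred and independent of all other terms. It therefore adds
  exactly sw2 |v|^2 to the variance of v^H x, while the remaining terms add a nonnegative
  amount.\<close>

lemma coercive_cov_xobs: "coercive (Mant p) (cov P (xobs p Z i) (xobs p Z i)) (sw2 p)"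
proof
  show "sw2 p > 0" by (rule sw2)
  show "cov P (xobs p Z i) (xobs p Z i) b a = cnj (cov P (xobs p Z i) (xobs p Z i) a b)" for a b
    by (rule cov_hermitian)
  fix v :: "nat \<Rightarrow> complex"
  let ?M = "Mant p" and ?x = "xobs p Z i"
  \<comment> \<open>The observation without its additive noise.\<close>
  define S where "S w m = of_real (sqrt (real (Kp p) * pw p i * epsv p * epsu p i)) * hch p Z i w m
    + of_real (sqrt (pw p i * epsv p * (1 - epsu p i))) * hch p Z i w m * Z (LU i i) w
    + of_real (sqrt (pw p (oth i) * epsv p * (1 - epsu p (oth i)))) * hch p Z (oth i) w m * Z (LU i (oth i)) w
    + of_real (sqrt (pw p i * (1 - epsv p))) * hch p Z i w m * Z (LV i i m) w
    + of_real (sqrt (pw p (oth i) * (1 - epsv p))) * hch p Z (oth i) w m * Z (LV i (oth i) m) w" for w m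
  have x: "?x w m = S w m + of_real (sqrt (sw2 p)) * Z (LW i m) w" for w m
    by (simp add: xobs_def S_def)
  let ?f = "\<lambda>w. \<Sum>a<?M. cnj (v a) * (S w a - meanv P ?x a)"
  let ?g = "\<lambda>w. \<Sum>a<?M. cnj (v a) * of_real (sqrt (sw2 p)) * Z (LW i a) w"
  \<comment> \<open>\<open>S\<close> depends only on labels other than the noise labels of this
    observation, so it can be separated from the noise.\<close>
  let ?K = "labels p - range (LW i)"
  have momS: "mom (\<lambda>w. S w m)" if "m < ?M" for m
    unfolding S_def using that by (intro mom_intros mom_hch mom_Z) simp_all
  have measS: "(\<lambda>w. S w m) \<in> borel_measurable (gen ?K)" if "m < ?M" for m
    unfolding S_def
    by (intro borel_measurable_add borel_measurable_times borel_measurable_const hch_measurable Z_measurable_gen)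
       (use that in auto)
  have f: "mom ?f" by (intro mom_intros momS) simp
  have g: "mom ?g" by (intro mom_intros mom_Z) simp
  have "expectation (\<lambda>w. ?f w * cnj (?g w)) = expectation ?f * expectation (\<lambda>w. cnj (?g w))"
  proof (rule expectation_mult_indep[where K = ?K and J = "LW i ` {..<?M}"])
    show "?f \<in> borel_measurable (gen ?K)"
      by (intro borel_measurable_sum borel_measurable_times borel_measurable_diff borel_measurable_const measS) simp
    show "(\<lambda>w. cnj (?g w)) \<in> borel_measurable (gen (LW i ` {..<?M}))"
      by (intro cnj_measurable borel_measurable_sum borel_measurable_times borel_measurable_const Z_measurable_gen) simp
  qed (use f g in \<open>auto intro: mom_cnj simp del: cnj_sum\<close>)
  also have "expectation (\<lambda>w. cnj (?g w)) = cnj (expectation ?g)"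
    by (rule Bochner_Integration.integral_cnj)
  also have "expectation ?g = (\<Sum>a<?M. expectation (\<lambda>w. cnj (v a) * of_real (sqrt (sw2 p)) * Z (LW i a) w))"
    by (intro Bochner_Integration.integral_sum mom_integrable mom_intros mom_Z) simp
  also have "\<dots> = 0" by (simp add: expectation_Z)
  finally have "expectation (\<lambda>w. (cmod (?f w + ?g w))\<^sup>2) =
      expectation (\<lambda>w. (cmod (?f w))\<^sup>2) + expectation (\<lambda>w. (cmod (?g w))\<^sup>2)"
    using f g by (intro expectation_norm2_add_orthogonal) simp_all
  also have "expectation (\<lambda>w. (cmod (?g w))\<^sup>2) = (\<Sum>a<?M. (cmod (cnj (v a) * of_real (sqrt (sw2 p))))\<^sup>2)"
    by (rule expectation_norm2_linear_combination) (auto simp: inj_on_def)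
  also have "\<dots> = sw2 p * (\<Sum>a<?M. (cmod (v a))\<^sup>2)"
    using sw2 by (simp add: norm_mult power_mult_distrib sum_distrib_left mult_ac)
  finally have "expectation (\<lambda>w. (cmod (?f w + ?g w))\<^sup>2) \<ge> sw2 p * (\<Sum>a<?M. (cmod (v a))\<^sup>2)"
    by simp
  moreover have "?f w + ?g w = (\<Sum>a<?M. cnj (v a) * (?x w a - meanv P ?x a))" for w
    unfolding sum.distrib[symmetric] x by (intro sum.cong refl) (simp add: algebra_simps)
  moreover have "hform ?M v (cov P ?x ?x) v =
      of_real (expectation (\<lambda>w. (cmod (\<Sum>a<?M. cnj (v a) * (?x w a - meanv P ?x a)))\<^sup>2))"
    unfolding cov_eq by (rule hform_gram) (intro mom_intros mom_xobs)
  ultimately show "sw2 p * (\<Sum>a<?M. (cmod (v a))\<^sup>2) \<le> Re (hform ?M v (cov P ?x ?x) v)"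
    by simp
qed

section \<open>Channel estimates and their errors\<close>

definition err :: "usr \<Rightarrow> 'w \<Rightarrow> nat \<Rightarrow> complex" where
  "err i = (\<lambda>w m. hch p Z i w m - hhat p P Z i w m)"

lemma hhat_eq:
  "hhat p P Z i = (\<lambda>w m. meanv P (hch p Z i) m
     + mvmul (Mant p) (mmul (Mant p) (cov P (hch p Z i) (xobs p Z i))
         (minv (Mant p) (cov P (xobs p Z i) (xobs p Z i))))
       (\<lambda>k. xobs p Z i w k - meanv P (xobs p Z i) k) m)"
  by (simp add: hhat_def Let_def fun_eq_iff)

lemmas is_inv_cov_xobs = coercive.is_inv_minv[OF coercive_cov_xobs]

lemma mom_hhat: "mom (\<lambda>w. hhat p P Z i w a)"
  by (rule mom_est[OF mom_hch mom_xobs is_inv_cov_xobs refl hhat_eq refl])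

lemma mom_err: "a < Mant p \<Longrightarrow> mom (\<lambda>w. err i w a)"
  unfolding err_def by (intro mom_intros mom_hch mom_hhat)

lemma expectation_norm2_hhat_le:
  assumes "a < Mant p"
  shows "expectation (\<lambda>w. (cmod (hhat p P Z i w a))\<^sup>2) \<le> eta p i"
  using expectation_norm2_est_le[OF mom_hch mom_xobs is_inv_cov_xobs refl hhat_eq refl assms]
  by (simp add: expectation_norm2_hch assms)

lemma Cerr_eq:
  assumes "a < Mant p" "b < Mant p"
  shows "Cerr p P Z i a b = expectation (\<lambda>w. err i w a * cnj (err i w b))"
  using cov_err[OF mom_hch mom_xobs is_inv_cov_xobs refl hhat_eq err_def assms]
  by (simp add: Cerr_def Let_def)

lemma Cerr_hermitian:
  assumes "a < Mant p" "b < Mant p"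
  shows "Cerr p P Z i b a = cnj (Cerr p P Z i a b)"
  unfolding Cerr_eq[OF assms] Cerr_eq[OF assms(2,1)] by (rule expectation_mult_cnj_commute)

lemma Cerr_psd: "0 \<le> Re (hform (Mant p) v (Cerr p P Z i) v)"
proof -
  have "hform (Mant p) v (Cerr p P Z i) v =
      hform (Mant p) v (\<lambda>a b. expectation (\<lambda>w. err i w a * cnj (err i w b))) v"
    by (rule hform_cong) (rule Cerr_eq)
  also have "\<dots> = of_real (expectation (\<lambda>w. (cmod (\<Sum>a<Mant p. cnj (v a) * err i w a))\<^sup>2))"
    by (rule hform_gram) (rule mom_err)
  finally show ?thesis by simp
qed

section \<open>The matrix R, bounds for \<open>zeta\<close>, and the rate\<close>

definition noise_floor :: real where
  "noise_floor = pw p Ur * (1 - epsv p) * eta p Ur + pw p Ut * (1 - epsv p) * eta p Ut + sw2 p"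

lemma eta_pos: "eta p j > 0"
  unfolding eta_def using rA[of j] rg[of j] rb[of j] kA[of j] kg[of j]
  by (intro add_nonneg_pos divide_nonneg_nonneg mult_nonneg_nonneg add_nonneg_nonneg) simp_all

lemma noise_floor_pos: "noise_floor > 0"
  unfolding noise_floor_def using sw2 pw eta_pos epsv
  by (intro add_nonneg_pos add_nonneg_nonneg mult_nonneg_nonneg) (simp_all add: less_imp_le)

text \<open>Under alignment the multiple of the identity in \<open>Rmat\<close> is exactly
  \<open>noise_floor\<close>. The error covariances are positive semidefinite and carry nonnegative
  weights.\<close>

lemma coercive_Rmat: "coercive (Mant p) (Rmat p P Z) noise_floor"
proof -
  have eta': "rA p j * rg p j * (1 + kg p j + kA p j) * real (Nios p j) / ((1 + kA p j) * (1 + kg p j))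
      + rb p j + rA p j * rg p j * kA p j * kg p j * (cmod (bil p j))\<^sup>2 / ((1 + kA p j) * (1 + kg p j))
      = eta p j" for j
    unfolding eta_def aligned by (simp add: add_divide_distrib algebra_simps)
  have "Rmat p P Z = (\<lambda>a b. of_real (pw p Ur * epsv p * (1 - epsu p Ur)) * Cerr p P Z Ur a b
     + (of_real (pw p Ut * epsv p * (1 - epsu p Ut)) * Cerr p P Z Ut a b
     + (if a = b then of_real noise_floor else 0)))"
    unfolding Rmat_def noise_floor_def eta' by (simp add: fun_eq_iff)
  moreover have "coercive (Mant p) \<dots> noise_floor"
    using pw epsv epsu
    by (intro coercive_add_scaled coercive_scaled_identity noise_floor_pos Cerr_hermitian Cerr_psd
        mult_nonneg_nonneg) (simp_all add: less_imp_le)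
  ultimately show ?thesis by simp
qed

text \<open>\<open>zeta\<close> is the rank-one corrected inverse form with the other user as
  \<open>y\<close>. The upper bound drops the interference term and then uses that the inverse of R
  is at most I / \<open>noise_floor\<close>.\<close>

lemma Re_zeta_bounds:
  shows "0 \<le> Re (zeta p P Z i w)"
    and "Re (zeta p P Z i w) \<le> (\<Sum>a<Mant p. (cmod (hhat p P Z i w a))\<^sup>2) / noise_floor"
proof -
  have c: "pw p (oth i) * epsv p \<ge> 0" using pw[of "oth i"] epsv by simp
  note zeta = zeta_def[of p P Z i w, unfolded Let_def]
  show "0 \<le> Re (zeta p P Z i w)"
    by (rule coercive.schur_nonneg[OF coercive_Rmat c zeta])
  show "Re (zeta p P Z i w) \<le> (\<Sum>a<Mant p. (cmod (hhat p P Z i w a))\<^sup>2) / noise_floor"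
    by (rule order_trans[OF coercive.schur_le[OF coercive_Rmat c zeta] coercive.hform_minv_le[OF coercive_Rmat]])
qed

theorem Rerg_le: "Rerg p P Z i \<le> Rbound p i"
proof -
  define a b where "a = pw p i * epsv p * epsu p i" and "b = pw p i * epsv p * (1 - epsu p i)"
  \<comment> \<open>A majorant of Re \<zeta> whose mean is at most \<open>z0\<close>.\<close>
  define z where "z w = (\<Sum>m<Mant p. (cmod (hhat p P Z i w m))\<^sup>2) / noise_floor" for w
  define z0 where "z0 = real (Mant p) * eta p i / noise_floor"
  define s where "s = a / ((1 + b * z0) * (1 + (a + b) * z0) * ln 2)"
  have ab: "a \<ge> 0" "b \<ge> 0"
    using pw[of i] epsv epsu[of i] by (auto simp: a_def b_def)
  have z0: "z0 \<ge> 0" using eta_pos[of i] noise_floor_pos by (simp add: z0_def)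
  have s: "s \<ge> 0" using ab z0 by (simp add: s_def)
  have "integrable P z"
    unfolding z_def by (intro integrable_divide_zero Bochner_Integration.integrable_sum mom_integrable_norm2 mom_hhat)
  have "expectation z = (\<Sum>m<Mant p. expectation (\<lambda>w. (cmod (hhat p P Z i w m))\<^sup>2)) / noise_floor"
    unfolding z_def by (simp add: Bochner_Integration.integral_sum mom_integrable_norm2 mom_hhat)
  also have "\<dots> \<le> z0"
    unfolding z0_def
    using noise_floor_pos sum_mono[of "{..<Mant p}" "\<lambda>m. expectation (\<lambda>w. (cmod (hhat p P Z i w m))\<^sup>2)" "\<lambda>_. eta p i"]
    by (intro divide_right_mono) (auto simp: expectation_norm2_hhat_le)
  finally have Ez: "expectation z \<le> z0" .
  have Rbound: "Rbound p i = log 2 (1 + a * z0 / (1 + b * z0))"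
  proof -
    \<comment> \<open>Multiplying numerator and denominator by \<open>noise_floor\<close> recovers
      the fraction in \<open>Rbound\<close>.\<close>
    have "a * z0 / (1 + b * z0) = a * (real (Mant p) * eta p i) / (b * (real (Mant p) * eta p i) + noise_floor)"
      unfolding z0_def using noise_floor_pos by (simp add: field_simps)
    then show ?thesis
      by (simp add: Rbound_def a_def b_def noise_floor_def mult.assoc add.assoc)
  qed
  \<comment> \<open>Monotonicity replaces Re \<zeta> by \<open>z\<close>, and the tangent at
    \<open>z0\<close> then makes the bound affine in \<open>z\<close>. Under expectation this plays
    the part of Jensen's inequality.\<close>
  have pointwise: "log 2 (1 + a * Re (zeta p P Z i w) / (1 + b * Re (zeta p P Z i w)))
      \<le> Rbound p i + s * (z w - z0)" for w
  proof -
    have "log 2 (1 + a * Re (zeta p P Z i w) / (1 + b * Re (zeta p P Z i w))) \<le> log 2 (1 + a * z w / (1 + b * z w))"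
      unfolding z_def by (intro rate_mono ab Re_zeta_bounds)
    also have "\<dots> \<le> Rbound p i + s * (z w - z0)"
      unfolding Rbound s_def using Re_zeta_bounds[of i w] by (intro rate_tangent ab z0) (simp add: z_def)
    finally show ?thesis .
  qed
  show ?thesis
  \<comment> \<open>The case split takes the place of a proof that the rate is integrable; the bound
    holds either way.\<close>
  proof (cases "integrable P (\<lambda>w. log 2 (1 + a * Re (zeta p P Z i w) / (1 + b * Re (zeta p P Z i w))))")
    case True
    have "Rerg p P Z i \<le> expectation (\<lambda>w. Rbound p i + s * (z w - z0))"
      unfolding Rerg_def Ex_def a_def[symmetric] b_def[symmetric]
      by (rule integral_mono[OF True _ pointwise]) (use \<open>integrable P z\<close> in simp)
    also have "\<dots> = Rbound p i + s * (expectation z - z0)"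
      using \<open>integrable P z\<close> by (simp add: prob_space)
    also have "\<dots> \<le> Rbound p i"
      using s Ez by (simp add: mult_nonneg_nonpos)
    finally show ?thesis .
  next
    case False
    \<comment> \<open>Junk value: the integral of a non-integrable function is 0.\<close>
    then have "Rerg p P Z i = 0"
      unfolding Rerg_def Ex_def a_def[symmetric] b_def[symmetric] by (rule not_integrable_integral_eq)
    also have "0 \<le> Rbound p i"
      unfolding Rbound using rate_mono[OF ab order_refl z0] by simp
    finally show ?thesis .
  qed
qed

end

theorem theorem5:
  fixes p :: params and P :: "'w measure" and Z :: "lbl \<Rightarrow> 'w \<Rightarrow> complex" and i :: usr
  assumes "prob_space P"
    and "std_cgauss_family P Z (labels p)"
    and "lam p > 0"
    and "0 \<le> epsv p" and "epsv p \<le> 1"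
    and "\<And>j. 0 \<le> epsu p j \<and> epsu p j \<le> 1"
    and "\<And>j. pw p j > 0"
    and "sw2 p > 0"
    and "Kp p \<ge> 1"
    and "\<And>j. rA p j > 0 \<and> rg p j > 0 \<and> rb p j > 0"
    and "\<And>j. kA p j \<ge> 0 \<and> kg p j \<ge> 0"
    and "\<And>j n. n \<in> ios p j \<Longrightarrow> 0 \<le> theta p j n \<and> theta p j n < 2 * pi"
    and "\<And>j. (cmod (bil p j))\<^sup>2 = (real (Nios p j))\<^sup>2"
  shows "Rerg p P Z i \<le> Rbound p i"
proof -
  interpret prob_space P by fact
  interpret ios_system P Z p
    using assms by unfold_locales auto
  show ?thesis by (rule Rerg_le)
qed

end
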